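(* Let $\lambda_1<\cdots<\lambda_n$ be real numbers, let $\Lambda=\operatorname{diag}(\lambda_1,\ldots,\lambda_n)$, let $\pi$ be a permutation of $\{1,\ldots,n\}$, and let $(\beta^\pi_1,\ldots,\beta^\pi_{n-1})\in\mathbb{R}^{n-1}$ be arbitrary (zero and negative coordinates are allowed). Run the inverse bidiagonal algorithm (defined in the context) on the input $\pi$, $\lambda^\pi_i=\lambda_{\pi(i)}$ ($1\le i\le n$), $\beta^\pi_i$ ($1\le i\le n-1$). Then the algorithm is well defined: for every $k=1,\ldots,n$ the first $k-1$ coordinates of $\tilde r_k$ vanish and its $k$-th coordinate $\tilde r_{k,k}$ is strictly positive, so that all divisions and square roots make sense. Moreover, the real symmetric tridiagonal matrix $T$ with diagonal entries $a_1,\ldots,a_n$ and off-diagonal entries $b_1,\ldots,b_{n-1}$ (that is, $T_{k,k}=a_k$ and $T_{k,k+1}=T_{k+1,k}=b_k$) returned by the algorithm is $\phi_\pi(\beta^\pi_1,\ldots,\beta^\pi_{n-1})$, i.e. it is the unique matrix $T\in\mathcal{U}^\pi_\Lambda$ whose $\pi$-bidiagonal coordinates are $(\beta^\pi_1,\ldots,\beta^\pi_{n-1})$.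
   Context: **The sets and coordinates.** Let $\mathcal{I}_\Lambda$ be the set of real symmetric tridiagonal $n\times n$ matrices with (simple) spectrum $\lambda_1<\cdots<\lambda_n$; it is a compact smooth manifold of dimension $n-1$. For a permutation $\pi$ let $P_\pi$ be the permutation matrix with $P_\pi e_i=e_{\pi(i)}$, let $\lambda^\pi_i=\lambda_{\pi(i)}$ and $\Lambda^\pi=\operatorname{diag}(\lambda^\pi_1,\ldots,\lambda^\pi_n)$. A star denotes transpose. Given $T\in\mathcal{I}_\Lambda$, write $T=Q^*\Lambda Q$ with $Q$ orthogonal. The set $\mathcal{U}^\pi_\Lambda\subset\mathcal{I}_\Lambda$ consists of those $T$ for which $P_\pi^{-1}Q$ is the product of a lower unipotent and an upper triangular matrix (i.e. all leading principal minors of $P_\pi^{-1}Q$ are nonzero; this does not depend on the choice of $Q$). It is an open dense subset of $\mathcal{I}_\Lambda$. For $T\in\mathcal{U}^\pi_\Lambda$ there is a unique diagonal matrix $E$ with diagonal entries $\pm1$ such that $Q_\pi=EP_\pi^{-1}Q$ factors as $Q_\pi=L_\pi U_\pi$ with $L_\pi$ lower unipotent and $U_\pi$ upper triangular with positive diagonal; then $T=Q_\pi^*\Lambda^\pi Q_\pi$. Put $R_\pi=U_\pi^{-1}$, so $L_\pi=Q_\pi R_\pi$. The matrix $B_\pi=L_\pi^{-1}\Lambda^\pi L_\pi=R_\pi^{-1}TR_\pi$ is lower bidiagonal with diagonal entries $\lambda^\pi_1,\ldots,\lambda^\pi_n$; its subdiagonal entries $\beta^\pi_i=(B_\pi)_{i+1,i}$,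 $1\le i\le n-1$, are the $\pi$-bidiagonal coordinates of $T$. The map $\psi_\pi:\mathcal{U}^\pi_\Lambda\to\mathbb{R}^{n-1}$, $T\mapsto(\beta^\pi_1,\ldots,\beta^\pi_{n-1})$, is known to be a diffeomorphism; $\phi_\pi=\psi_\pi^{-1}$ is its inverse. **Auxiliary matrices.** For an integer $k\ge0$ and given $\lambda^\pi_i$, $\beta^\pi_i$, let $L_{\pi,k}$ be the lower unipotent matrix with entries, for $i>j$, $$(L_{\pi,k})_{i,j}=\frac{(\beta^\pi_j\beta^\pi_{j+1}\cdots\beta^\pi_{i-1})^k}{(\lambda^\pi_i-\lambda^\pi_j)(\lambda^\pi_i-\lambda^\pi_{j+1})\cdots(\lambda^\pi_i-\lambda^\pi_{i-1})},$$ with the convention that the numerator equals $1$ when $k=0$. Let $B_{\pi,2}$ be the lower bidiagonal matrix with diagonal entries $\lambda^\pi_1,\ldots,\lambda^\pi_n$ and subdiagonal entries $(B_{\pi,2})_{i+1,i}=(\beta^\pi_i)^2$. **The inverse bidiagonal algorithm.** Set $\tilde r_0=0\in\mathbb{R}^n$, $b_0=0$ and $\tilde r_1=L_{\pi,2}^*L_{\pi,0}e_1\in\mathbb{R}^n$. Denote by $\tilde r_{k,j}$ the $j$-th coordinate of $\tilde r_k$. For $k=1,2,\ldots,n$ successively: (1) if $k\ge2$, set $b_{k-1}=\beta^\pi_{k-1}\sqrt{\tilde r_{k,k}/\tilde r_{k-1,k-1}}$; (2) set $a_k=\big((\tilde r_k^*B_{\pi,2})_k-b_{k-1}^2\tilde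 r_{k-1,k}\big)/\tilde r_{k,k}$, where $(\cdot)_k$ denotes the $k$-th coordinate; (3) if $k<n$, set $\tilde r_{k+1}^*=\tilde r_k^*B_{\pi,2}-a_k\tilde r_k^*-b_{k-1}^2\tilde r_{k-1}^*$. The output is $a_1,\ldots,a_n,b_1,\ldots,b_{n-1}$. *)

theory Defs
  imports
    "Jordan_Normal_Form.Spectral_Radius"
    "Jordan_Normal_Form.Gauss_Jordan_Elimination"
    "HOL-Combinatorics.Permutations"
begin

text \<open>
  Matrices and vectors are indexed from 0, and \<open>\<pi>\<close> permutes \<open>{..<n}\<close>; thus the entry written
  $\lambda_i$, $\beta_i$ or $M_{i,j}$ with indices starting at 1 is \<open>lam (i - 1)\<close>, \<open>\<beta> $ (i - 1)\<close>
  or \<open>M $$ (i - 1, j - 1)\<close> below. Only the step counter of the inverse bidiagonal algorithm,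
  and the subscripts of its output, start at 1.
\<close>

section \<open>Matrices\<close>

definition diag_of :: "nat \<Rightarrow> (nat \<Rightarrow> real) \<Rightarrow> real mat" where
  "diag_of n d = mat n n (\<lambda>(i, j). if i = j then d i else 0)"

definition perm_mat :: "nat \<Rightarrow> (nat \<Rightarrow> nat) \<Rightarrow> real mat" where
  "perm_mat n \<pi> = mat n n (\<lambda>(i, j). if i = \<pi> j then 1 else 0)"

text \<open>Unspecified on singular matrices.\<close>
definition inv_mat :: "real mat \<Rightarrow> real mat" where
  "inv_mat A = the (mat_inverse A)"

definition real_orthogonal :: "nat \<Rightarrow> real mat \<Rightarrow> bool" where
  "real_orthogonal n Q \<longleftrightarrow> Q \<in> carrier_mat n n \<and> Q\<^sup>T * Q = 1\<^sub>m n"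

definition lower_unipotent :: "nat \<Rightarrow> real mat \<Rightarrow> bool" where
  "lower_unipotent n L \<longleftrightarrow> L \<in> carrier_mat n n \<and>
     (\<forall>i < n. L $$ (i, i) = 1) \<and> (\<forall>i < n. \<forall>j < n. i < j \<longrightarrow> L $$ (i, j) = 0)"

definition sign_diagonal :: "nat \<Rightarrow> real mat \<Rightarrow> bool" where
  "sign_diagonal n E \<longleftrightarrow> (\<exists>\<epsilon>. (\<forall>i < n. \<epsilon> i = 1 \<or> \<epsilon> i = -1) \<and> E = diag_of n \<epsilon>)"

definition sym_tridiagonal :: "nat \<Rightarrow> real mat \<Rightarrow> bool" where
  "sym_tridiagonal n T \<longleftrightarrow> T \<in> carrier_mat n n \<and> T\<^sup>T = T \<and>
     (\<forall>i < n. \<forall>j < n. i + 1 < j \<or> j + 1 < i \<longrightarrow> T $$ (i, j) = 0)"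


section \<open>Isospectral tridiagonal matrices and bidiagonal coordinates\<close>

text \<open>For \<open>lam\<close> injective on \<open>{..<n}\<close>, equality of the sets forces the spectrum to be simple.\<close>
definition isospectral_tridiag :: "nat \<Rightarrow> (nat \<Rightarrow> real) \<Rightarrow> real mat set" where
  "isospectral_tridiag n lam = {T. sym_tridiagonal n T \<and> spectrum T = lam ` {..<n}}"

definition bidiag_domain :: "nat \<Rightarrow> (nat \<Rightarrow> real) \<Rightarrow> (nat \<Rightarrow> nat) \<Rightarrow> real mat set" where
  "bidiag_domain n lam \<pi> = {T \<in> isospectral_tridiag n lam.
     \<exists>Q L U. real_orthogonal n Q \<and> T = Q\<^sup>T * diag_of n lam * Q \<and>
       lower_unipotent n L \<and>
       U \<in> carrier_mat n n \<and> upper_triangular U \<and>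
       inv_mat (perm_mat n \<pi>) * Q = L * U}"

text \<open>\<open>(Q\<^sub>\<pi>, L\<^sub>\<pi>, U\<^sub>\<pi>)\<close> as a relation; on \<open>bidiag_domain n lam \<pi>\<close> the triple is determined by \<open>T\<close>.\<close>
definition is_pi_factorization ::
  "nat \<Rightarrow> (nat \<Rightarrow> real) \<Rightarrow> (nat \<Rightarrow> nat) \<Rightarrow> real mat \<Rightarrow> real mat \<times> real mat \<times> real mat \<Rightarrow> bool" where
  "is_pi_factorization n lam \<pi> T = (\<lambda>(Q\<^sub>\<pi>, L, U).
     (\<exists>Q E. real_orthogonal n Q \<and> T = Q\<^sup>T * diag_of n lam * Q \<and>
        sign_diagonal n E \<and> Q\<^sub>\<pi> = E * (inv_mat (perm_mat n \<pi>) * Q)) \<and>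
     Q\<^sub>\<pi> = L * U \<and> lower_unipotent n L \<and>
     U \<in> carrier_mat n n \<and> upper_triangular U \<and> (\<forall>i < n. 0 < U $$ (i, i)))"

definition pi_factorization ::
  "nat \<Rightarrow> (nat \<Rightarrow> real) \<Rightarrow> (nat \<Rightarrow> nat) \<Rightarrow> real mat \<Rightarrow> real mat \<times> real mat \<times> real mat" where
  "pi_factorization n lam \<pi> T = (THE F. is_pi_factorization n lam \<pi> T F)"

definition bidiag_mat :: "nat \<Rightarrow> (nat \<Rightarrow> real) \<Rightarrow> (nat \<Rightarrow> nat) \<Rightarrow> real mat \<Rightarrow> real mat" where
  "bidiag_mat n lam \<pi> T =
     (case pi_factorization n lam \<pi> T of (Q\<^sub>\<pi>, L, U) \<Rightarrow> inv_mat L * diag_of n (lam \<circ> \<pi>) * L)"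

definition psi :: "nat \<Rightarrow> (nat \<Rightarrow> real) \<Rightarrow> (nat \<Rightarrow> nat) \<Rightarrow> real mat \<Rightarrow> real vec" where
  "psi n lam \<pi> T = vec (n - 1) (\<lambda>i. bidiag_mat n lam \<pi> T $$ (i + 1, i))"

definition phi :: "nat \<Rightarrow> (nat \<Rightarrow> real) \<Rightarrow> (nat \<Rightarrow> nat) \<Rightarrow> real vec \<Rightarrow> real mat" where
  "phi n lam \<pi> = the_inv_into (bidiag_domain n lam \<pi>) (psi n lam \<pi>)"


section \<open>The inverse bidiagonal algorithm\<close>

text \<open>In this section \<open>\<mu>\<close> stands for the permuted eigenvalues \<open>lam \<circ> \<pi>\<close>.\<close>

definition L_aux :: "nat \<Rightarrow> (nat \<Rightarrow> real) \<Rightarrow> real vec \<Rightarrow> nat \<Rightarrow> real mat" where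
  "L_aux n \<mu> \<beta> k = mat n n (\<lambda>(i, j).
     if i < j then 0 else if i = j then 1
     else (\<Prod>m = j..<i. \<beta> $ m) ^ k / (\<Prod>m = j..<i. \<mu> i - \<mu> m))"

definition B2_aux :: "nat \<Rightarrow> (nat \<Rightarrow> real) \<Rightarrow> real vec \<Rightarrow> real mat" where
  "B2_aux n \<mu> \<beta> = mat n n (\<lambda>(i, j).
     if i = j then \<mu> i else if i = j + 1 then (\<beta> $ j)\<^sup>2 else 0)"

text \<open>
  \<open>alg_r k\<close>, \<open>alg_a k\<close> and \<open>alg_b k\<close> are $\tilde r_k$, $a_k$ and $b_k$; the row vector
  $\tilde r_k^* B_{\pi,2}$ is rendered as \<open>(B2_aux n \<mu> \<beta>)\<^sup>T *\<^sub>v alg_r n \<mu> \<beta> k\<close>.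
  The value \<open>alg_a 0\<close> and the values beyond step \<open>n\<close> are not part of the algorithm.
\<close>
function alg_r :: "nat \<Rightarrow> (nat \<Rightarrow> real) \<Rightarrow> real vec \<Rightarrow> nat \<Rightarrow> real vec"
  and alg_a :: "nat \<Rightarrow> (nat \<Rightarrow> real) \<Rightarrow> real vec \<Rightarrow> nat \<Rightarrow> real"
  and alg_b :: "nat \<Rightarrow> (nat \<Rightarrow> real) \<Rightarrow> real vec \<Rightarrow> nat \<Rightarrow> real" where
  "alg_r n \<mu> \<beta> 0 = 0\<^sub>v n"
| "alg_r n \<mu> \<beta> (Suc 0) = (L_aux n \<mu> \<beta> 2)\<^sup>T *\<^sub>v (L_aux n \<mu> \<beta> 0 *\<^sub>v unit_vec n 0)"
| "alg_r n \<mu> \<beta> (Suc (Suc k)) =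
     (B2_aux n \<mu> \<beta>)\<^sup>T *\<^sub>v alg_r n \<mu> \<beta> (Suc k)
       - alg_a n \<mu> \<beta> (Suc k) \<cdot>\<^sub>v alg_r n \<mu> \<beta> (Suc k)
       - (alg_b n \<mu> \<beta> k)\<^sup>2 \<cdot>\<^sub>v alg_r n \<mu> \<beta> k"
| "alg_a n \<mu> \<beta> 0 = 0"
| "alg_a n \<mu> \<beta> (Suc k) =
     (((B2_aux n \<mu> \<beta>)\<^sup>T *\<^sub>v alg_r n \<mu> \<beta> (Suc k)) $ k
       - (alg_b n \<mu> \<beta> k)\<^sup>2 * alg_r n \<mu> \<beta> k $ k) / alg_r n \<mu> \<beta> (Suc k) $ k"
| "alg_b n \<mu> \<beta> 0 = 0"
| "alg_b n \<mu> \<beta> (Suc k) =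
     \<beta> $ k * sqrt (alg_r n \<mu> \<beta> (Suc (Suc k)) $ (Suc k) / alg_r n \<mu> \<beta> (Suc k) $ k)"
  by pat_completeness auto
termination
  by (relation "measure (\<lambda>x. case x of
        Inl (n, \<mu>, \<beta>, k) \<Rightarrow> 3 * k
      | Inr (Inl (n, \<mu>, \<beta>, k)) \<Rightarrow> 3 * k + 2
      | Inr (Inr (n, \<mu>, \<beta>, k)) \<Rightarrow> 3 * k + 4)") auto

definition alg_output :: "nat \<Rightarrow> (nat \<Rightarrow> real) \<Rightarrow> real vec \<Rightarrow> real mat" where
  "alg_output n \<mu> \<beta> = mat n n (\<lambda>(i, j).
     if i = j then alg_a n \<mu> \<beta> (i + 1)
     else if j = i + 1 then alg_b n \<mu> \<beta> (i + 1)
     else if i = j + 1 then alg_b n \<mu> \<beta> (j + 1)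
     else 0)"

end

theory Submission
  imports Defs
begin

text \<open>
  Write \<open>\<mu> = lam \<circ> \<pi>\<close>, \<open>M = diag \<mu>\<close>, and let \<open>L\<^sub>k\<close> be the auxiliary unipotent matrices and
  \<open>B\<^sub>k\<close> the lower bidiagonal matrix with diagonal \<open>\<mu>\<close> and subdiagonal \<open>\<beta>\<^sup>k\<close>. The entries of \<open>L\<^sub>k\<close>
  solve the eigenvector recursion \<open>M L\<^sub>k = L\<^sub>k B\<^sub>k\<close> for every \<open>k\<close>, and for \<open>k = 1\<close> this equation has
  no other unipotent solution. So a matrix \<open>T\<close> has bidiagonal coordinates \<open>\<beta>\<close> exactly when
  \<open>T = Q\<^sup>T M Q\<close> with \<open>Q = L\<^sub>1 U\<close> orthogonal and \<open>U\<close> upper triangular with positive diagonal. Such a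
  \<open>U\<close> exists by Gram-Schmidt (\<open>orthonormalize_columns\<close>), and the claim reduces to this: for \<^emph>\<open>any\<close>
  such \<open>U\<close> the algorithm is well defined and returns \<open>T\<close>. Existence and uniqueness both follow
  from that one statement.

  With \<open>F = L\<^sub>1\<^sup>T Q\<close>, the transposed inverse of \<open>U\<close>, one has \<open>T F\<^sup>T = F\<^sup>T B\<^sub>1\<close>, a three-term recursion
  for the columns of \<open>F\<close>. When all \<open>\<beta>\<close> are nonzero, rescaling \<open>F\<close> by products of the \<open>\<beta>\<close> gives the
  vectors of the algorithm, but this says nothing when some \<open>\<beta>\<close> vanish. The argument that covers
  all \<open>\<beta>\<close> at once replaces the Gram matrix \<open>G = L\<^sub>1\<^sup>T L\<^sub>1\<close> by \<open>H = L\<^sub>2\<^sup>T L\<^sub>0\<close>. Generically \<open>H\<close> is a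
  diagonal conjugate of \<open>G\<close>; in general its entries agree with those of \<open>G\<close> up to products of the
  \<open>\<beta>\<close> (\<open>twisted_gram_mat_lower\<close>, \<open>twisted_gram_mat_upper\<close>), and it satisfies
  \<open>B\<^sub>2\<^sup>T H = H B\<^sub>0\<close> (\<open>twisted_gram_mat_intertwines\<close>), where the subdiagonal of \<open>B\<^sub>0\<close> consists of ones
  and so never degenerates.

  The \<open>k\<close>-th vector of the algorithm is then characterised as the combination of the first \<open>k\<close>
  columns of \<open>H\<close>, the last one with coefficient 1, whose first \<open>k - 1\<close> coordinates vanish. A column
  of \<open>U\<close>, multiplied by products of the \<open>\<beta>\<close>, supplies the coefficients of such a combination
  (\<open>rvec_before\<close>), and shows that its \<open>k\<close>-th coordinate is the square of a diagonal entry of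
  \<open>F\<close>, hence positive. By \<open>B\<^sub>2\<^sup>T H = H B\<^sub>0\<close> one step of the algorithm produces again
  a combination of this kind; as the leading minors of \<open>H\<close> do not vanish
  (\<open>twisted_gram_mat_leading_injective\<close>), it is the right one (\<open>rvec_recursion\<close>).
\<close>

section \<open>Square, triangular and Hessenberg matrices\<close>

lemma mult_entry:
  assumes "A \<in> carrier_mat n n" "B \<in> carrier_mat n n" "i < n" "j < n"
  shows "(A * B) $$ (i, j) = (\<Sum>m<n. A $$ (i, m) * B $$ (m, j))"
  using assms by (auto simp: scalar_prod_def atLeast0LessThan intro!: sum.cong)

lemma square_mult_carrier [simp]:
  "A \<in> carrier_mat n n \<Longrightarrow> B \<in> carrier_mat n n \<Longrightarrow> A * B \<in> carrier_mat n n"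
  by (rule mult_carrier_mat)

lemma mult_vec_entry:
  assumes "A \<in> carrier_mat n n" "v \<in> carrier_vec n" "i < n"
  shows "(A *\<^sub>v v) $ i = (\<Sum>m<n. A $$ (i, m) * v $ m)"
  using assms by (auto simp: scalar_prod_def atLeast0LessThan intro!: sum.cong)

lemma mult_inverse_cancel:
  fixes A :: "real mat"
  assumes "A * B = 1\<^sub>m n" "A \<in> carrier_mat n n" "B \<in> carrier_mat n n" "C \<in> carrier_mat n n"
  shows "A * (B * C) = C"
  using assms by (metis assoc_mult_mat left_mult_one_mat)

lemma inv_mat_eq:
  fixes A :: "real mat"
  assumes A: "A \<in> carrier_mat n n" and B: "B \<in> carrier_mat n n" and AB: "A * B = 1\<^sub>m n"
  shows "inv_mat A = B"
proof -
  have BA: "B * A = 1\<^sub>m n" by (rule mat_mult_left_right_inverse[OF A B AB])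
  have "A \<in> Units (ring_mat TYPE(real) n n)"
    unfolding Units_def ring_mat_def using A B AB BA by auto
  then obtain C where C: "mat_inverse A = Some C"
    using mat_inverse(1)[OF A, of n] by fastforce
  from mat_inverse(2)[OF A C] have "A * C = 1\<^sub>m n" "C \<in> carrier_mat n n" by auto
  then have "C = B" by (metis BA B mult_inverse_cancel A right_mult_one_mat)
  with C show ?thesis by (simp add: inv_mat_def)
qed

lemma right_inverse_if_det:
  fixes A :: "real mat"
  assumes A: "A \<in> carrier_mat n n" and "det A \<noteq> 0"
  obtains B where "B \<in> carrier_mat n n" "A * B = 1\<^sub>m n" "B * A = 1\<^sub>m n"
proof -
  have "A \<in> Units (ring_mat TYPE(real) n n)" by (rule det_non_zero_imp_unit[OF assms])
  then show ?thesis using that unfolding Units_def ring_mat_def by auto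
qed

lemma diag_of_carrier [simp]: "diag_of n d \<in> carrier_mat n n"
  by (simp add: diag_of_def)

lemma diag_of_mult_entry:
  assumes "A \<in> carrier_mat n n" "i < n" "j < n"
  shows "(diag_of n d * A) $$ (i, j) = d i * A $$ (i, j)"
    and "(A * diag_of n d) $$ (i, j) = A $$ (i, j) * d j"
  using assms
  by (simp_all add: mult_entry[where n = n] diag_of_def if_distrib[of "\<lambda>x. x * _"]
      if_distrib[of "\<lambda>x. _ * x"] cong: if_cong del: index_mult_mat(1))

lemma diag_of_dims [simp]: "dim_row (diag_of n d) = n" "dim_col (diag_of n d) = n"
  by (simp_all add: diag_of_def)

lemma diag_of_mult: "diag_of n d * diag_of n e = diag_of n (\<lambda>i. d i * e i)"
  by (rule eq_matI) (auto simp: diag_of_mult_entry simp del: index_mult_mat(1), auto simp: diag_of_def)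

lemma diag_of_transpose [simp]: "(diag_of n d)\<^sup>T = diag_of n d"
  by (auto simp: diag_of_def)

lemma diag_of_one: "(\<And>i. i < n \<Longrightarrow> d i = 1) \<Longrightarrow> diag_of n d = 1\<^sub>m n"
  by (auto simp: diag_of_def)

definition lower_tri :: "nat \<Rightarrow> real mat \<Rightarrow> bool" where
  "lower_tri n A \<longleftrightarrow> A \<in> carrier_mat n n \<and> (\<forall>i<n. \<forall>j<n. i < j \<longrightarrow> A $$ (i, j) = 0)"

definition upper_tri :: "nat \<Rightarrow> real mat \<Rightarrow> bool" where
  "upper_tri n A \<longleftrightarrow> A \<in> carrier_mat n n \<and> (\<forall>i<n. \<forall>j<n. j < i \<longrightarrow> A $$ (i, j) = 0)"

lemma upper_tri_iff: "upper_tri n A \<longleftrightarrow> A \<in> carrier_mat n n \<and> upper_triangular A"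
  by (auto simp: upper_tri_def)

lemma upper_tri_transpose: "upper_tri n A\<^sup>T \<longleftrightarrow> lower_tri n A"
  by (auto simp: upper_tri_def lower_tri_def)

lemma lower_tri_mult_entry:
  assumes "lower_tri n A" "B \<in> carrier_mat n n" "i < n" "j < n"
  shows "(A * B) $$ (i, j) = A $$ (i, i) * B $$ (i, j) + (\<Sum>m<i. A $$ (i, m) * B $$ (m, j))"
proof -
  have "(A * B) $$ (i, j) = (\<Sum>m<n. A $$ (i, m) * B $$ (m, j))"
    using assms by (simp add: mult_entry[where n = n] lower_tri_def)
  also have "\<dots> = (\<Sum>m<Suc i. A $$ (i, m) * B $$ (m, j))"
    using assms by (intro sum.mono_neutral_right) (auto simp: lower_tri_def)
  finally show ?thesis by simp
qed

lemma lower_tri_mult: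
  assumes "lower_tri n A" "lower_tri n B"
  shows "lower_tri n (A * B)"
    and "i < n \<Longrightarrow> (A * B) $$ (i, i) = A $$ (i, i) * B $$ (i, i)"
proof -
  have B: "B \<in> carrier_mat n n" using assms by (simp add: lower_tri_def)
  show "lower_tri n (A * B)"
    using assms by (auto simp: lower_tri_def lower_tri_mult_entry[OF assms(1) B] simp del: index_mult_mat(1))
  show "i < n \<Longrightarrow> (A * B) $$ (i, i) = A $$ (i, i) * B $$ (i, i)"
    using assms by (auto simp: lower_tri_def lower_tri_mult_entry[OF assms(1) B] simp del: index_mult_mat(1))
qed

text \<open>
  Forward substitution: row \<open>i\<close> of \<open>X\<close> is determined by row \<open>i\<close> of \<open>A * X\<close> and the earlier rows
  of \<open>X\<close>. This shows that inverses and quotients of triangular matrices are triangular.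
\<close>
lemma lower_tri_cancel_left:
  assumes A: "lower_tri n A" and d: "\<And>i. i < n \<Longrightarrow> A $$ (i, i) \<noteq> 0"
    and X: "X \<in> carrier_mat n n" and AX: "lower_tri n (A * X)"
  shows "lower_tri n X"
proof -
  have "\<forall>j<n. i < j \<longrightarrow> X $$ (i, j) = 0" if "i < n" for i
    using that
  proof (induction i rule: less_induct)
    case (less i)
    show ?case
    proof (intro allI impI)
      fix j assume j: "j < n" "i < j"
      have "(\<Sum>m<i. A $$ (i, m) * X $$ (m, j)) = 0"
        using less j by (intro sum.neutral) auto
      moreover have "(A * X) $$ (i, j) = 0"
        using AX j less.prems unfolding lower_tri_def by blast
      ultimately show "X $$ (i, j) = 0"
        using lower_tri_mult_entry[OF A X less.prems j(1)] d[OF less.prems] by simp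
    qed
  qed
  then show ?thesis using X by (auto simp: lower_tri_def)
qed

lemma upper_tri_mult:
  assumes "upper_tri n A" "upper_tri n B"
  shows "upper_tri n (A * B)"
    and "i < n \<Longrightarrow> (A * B) $$ (i, i) = A $$ (i, i) * B $$ (i, i)"
proof -
  have c: "A \<in> carrier_mat n n" "B \<in> carrier_mat n n" using assms by (auto simp: upper_tri_def)
  have t: "lower_tri n A\<^sup>T" "lower_tri n B\<^sup>T" using assms by (auto simp: upper_tri_def lower_tri_def)
  have e: "(A * B)\<^sup>T = B\<^sup>T * A\<^sup>T" using c by (rule transpose_mult)
  show "upper_tri n (A * B)"
    using lower_tri_mult(1)[OF t(2,1)] upper_tri_transpose[of n "(A * B)\<^sup>T"]
    by (metis e Matrix.transpose_transpose)
  assume i: "i < n"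
  have "(A * B) $$ (i, i) = (B\<^sup>T * A\<^sup>T) $$ (i, i)" using c i by (simp flip: e)
  also have "\<dots> = A $$ (i, i) * B $$ (i, i)" using lower_tri_mult(2)[OF t(2,1) i] c i by simp
  finally show "(A * B) $$ (i, i) = A $$ (i, i) * B $$ (i, i)" .
qed

lemma upper_tri_cancel_right:
  assumes U: "upper_tri n U" and d: "\<And>i. i < n \<Longrightarrow> U $$ (i, i) \<noteq> 0"
    and X: "X \<in> carrier_mat n n" and XU: "upper_tri n (X * U)"
  shows "upper_tri n X"
proof -
  have c: "U \<in> carrier_mat n n" using U by (simp add: upper_tri_def)
  have "lower_tri n U\<^sup>T" using U by (auto simp: upper_tri_def lower_tri_def)
  moreover have "lower_tri n (U\<^sup>T * X\<^sup>T)"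
    using XU upper_tri_transpose[of n "(X * U)\<^sup>T"] transpose_mult[OF X c] by (metis Matrix.transpose_transpose)
  ultimately have "lower_tri n X\<^sup>T"
    using lower_tri_cancel_left[of n "U\<^sup>T" "X\<^sup>T"] d X c by auto
  then show ?thesis using upper_tri_transpose[of n "X\<^sup>T"] by simp
qed

lemma lower_tri_det:
  assumes "lower_tri n A" "\<And>i. i < n \<Longrightarrow> A $$ (i, i) \<noteq> 0"
  shows "det A \<noteq> 0"
proof -
  have c: "A \<in> carrier_mat n n" using assms by (simp add: lower_tri_def)
  have "det A = prod_list (diag_mat A)"
    using assms by (intro det_lower_triangular[of n]) (auto simp: lower_tri_def)
  then show ?thesis using assms(2) c by (auto simp: prod_list_zero_iff diag_mat_def)
qed

lemma upper_tri_det: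
  assumes "upper_tri n A"
  shows "det A \<noteq> 0 \<longleftrightarrow> (\<forall>i<n. A $$ (i, i) \<noteq> 0)"
  using assms upper_triangular_imp_det_eq_0_iff[of A n] by (auto simp: upper_tri_iff diag_mat_def)

definition upper_hess :: "nat \<Rightarrow> real mat \<Rightarrow> bool" where
  "upper_hess n A \<longleftrightarrow> A \<in> carrier_mat n n \<and> (\<forall>i<n. \<forall>j<n. j + 1 < i \<longrightarrow> A $$ (i, j) = 0)"

lemma upper_hess_mult:
  assumes "upper_tri n U" "upper_hess n A"
  shows "upper_hess n (U * A)" "upper_hess n (A * U)"
proof -
  have c: "U \<in> carrier_mat n n" "A \<in> carrier_mat n n"
    using assms by (auto simp: upper_tri_def upper_hess_def)
  show "upper_hess n (U * A)"
    unfolding upper_hess_def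
  proof (intro conjI allI impI)
    fix i j assume "i < n" "j < n" "j + 1 < i"
    then show "(U * A) $$ (i, j) = 0"
      using assms unfolding mult_entry[OF c \<open>i < n\<close> \<open>j < n\<close>] upper_tri_def upper_hess_def
      by (intro sum.neutral ballI) (metis (no_types, lifting) lessThan_iff linorder_not_less mult_eq_0_iff order_less_le_trans)
  qed (use c in auto)
  show "upper_hess n (A * U)"
    unfolding upper_hess_def
  proof (intro conjI allI impI)
    fix i j assume ij: "i < n" "j < n" "j + 1 < i"
    show "(A * U) $$ (i, j) = 0"
      unfolding mult_entry[OF c(2,1) ij(1,2)]
    proof (intro sum.neutral ballI)
      fix m assume "m \<in> {..<n}"
      then show "A $$ (i, m) * U $$ (m, j) = 0"
        using assms ij unfolding upper_tri_def upper_hess_def by (cases "m \<le> j") auto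
    qed
  qed (use c in auto)
qed

section \<open>Orthonormalization by an upper triangular matrix\<close>

text \<open>
  Gram-Schmidt for the inner product \<open>f\<close> that \<open>L\<close> pulls back from the standard one, applied to
  the unit vectors in their order; the coefficient vectors obtained are therefore triangular.
\<close>
lemma orthonormalize_columns:
  assumes L: "lower_unipotent n L"
  shows "\<exists>U. upper_tri n U \<and> (\<forall>i<n. 0 < U $$ (i, i)) \<and> (L * U)\<^sup>T * (L * U) = 1\<^sub>m n"
proof -
  have Lc: "L \<in> carrier_mat n n" using L by (simp add: lower_unipotent_def)
  define Y where "Y x s = (\<Sum>i<n. L $$ (s, i) * x i)" for x :: "nat \<Rightarrow> real" and s
  define f where "f x y = (\<Sum>s<n. Y x s * Y y s)" for x y
  have fpos: "0 < f x x" if x: "m < n" "x m \<noteq> 0" for x m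
  proof -
    \<comment> \<open>the first nonzero coordinate of a vector is preserved by a unipotent matrix\<close>
    define l where "l = (LEAST m. x m \<noteq> 0)"
    have l: "x l \<noteq> 0" "l \<le> m"
      using LeastI[of "\<lambda>m. x m \<noteq> 0", OF x(2)] Least_le[of "\<lambda>m. x m \<noteq> 0", OF x(2)]
      unfolding l_def by blast+
    have lz: "x i = 0" if "i < l" for i
      using not_less_Least[of i "\<lambda>m. x m \<noteq> 0"] that by (simp add: l_def)
    have ln: "l < n" using l x by simp
    have "Y x l = (\<Sum>i\<in>{l}. L $$ (l, i) * x i)"
      unfolding Y_def using L lz ln
      by (intro sum.mono_neutral_right)
        (auto simp: lower_unipotent_def, metis linorder_neqE_nat)
    then have "Y x l \<noteq> 0" using L ln l by (simp add: lower_unipotent_def)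
    then show ?thesis
      unfolding f_def using ln by (intro sum_pos2[of _ l]) (auto simp: zero_less_mult_iff)
  qed
  have "\<exists>u. \<forall>i<k. 0 < u i i \<and> (\<forall>m. i < m \<longrightarrow> u i m = 0) \<and> (\<forall>j<k. f (u i) (u j) = (if i = j then 1 else 0))"
    if "k \<le> n" for k
    using that
  proof (induction k)
    case (Suc k)
    then obtain u where u: "\<And>i. i < k \<Longrightarrow> 0 < u i i" "\<And>i m. i < k \<Longrightarrow> i < m \<Longrightarrow> u i m = 0"
      "\<And>i j. i < k \<Longrightarrow> j < k \<Longrightarrow> f (u i) (u j) = (if i = j then 1 else 0)"
      by (metis less_imp_le Suc_le_lessD)
    define e where "e m = (if m = k then 1 else 0 :: real)" for m
    define v where "v m = e m - (\<Sum>i<k. f e (u i) * u i m)" for m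
    have vk: "v k = 1" using u(2) by (auto simp: v_def e_def intro!: sum.neutral)
    have vb: "v m = 0" if "k < m" for m
      using that u(2) by (auto simp: v_def e_def intro!: sum.neutral)
    have Yv: "Y v s = Y e s - (\<Sum>i<k. f e (u i) * Y (u i) s)" for s
    proof -
      have "Y v s = Y e s - (\<Sum>m<n. \<Sum>i<k. f e (u i) * (L $$ (s, m) * u i m))"
        by (simp add: Y_def v_def right_diff_distrib sum_subtractf sum_distrib_left mult_ac)
      also have "(\<Sum>m<n. \<Sum>i<k. f e (u i) * (L $$ (s, m) * u i m)) = (\<Sum>i<k. f e (u i) * Y (u i) s)"
        unfolding Y_def sum_distrib_left by (rule sum.swap)
      finally show ?thesis .
    qed
    have orth: "f v (u j) = 0" if j: "j < k" for j
    proof -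
      have "f v (u j) = (\<Sum>s<n. Y v s * Y (u j) s)" by (simp only: f_def)
      also have "\<dots> = (\<Sum>s<n. Y e s * Y (u j) s) - (\<Sum>s<n. \<Sum>i<k. f e (u i) * (Y (u i) s * Y (u j) s))"
        by (simp add: Yv left_diff_distrib sum_subtractf sum_distrib_right mult.assoc)
      also have "(\<Sum>s<n. Y e s * Y (u j) s) = f e (u j)" by (simp only: f_def)
      also have "(\<Sum>s<n. \<Sum>i<k. f e (u i) * (Y (u i) s * Y (u j) s)) = (\<Sum>i<k. f e (u i) * f (u i) (u j))"
        unfolding f_def[of "u _" "u j"] sum_distrib_left by (rule sum.swap)
      also have "\<dots> = (\<Sum>i<k. if i = j then f e (u i) else 0)"
        using u(3) j by (intro sum.cong) auto
      finally show ?thesis using j by simp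
    qed
    define c where "c = 1 / sqrt (f v v)"
    have fv: "0 < f v v" using fpos[of k v] vk Suc by simp
    have c: "0 < c" "c * c * f v v = 1" using fv by (auto simp: c_def)
    have f_scale: "f (\<lambda>m. c * x m) y = c * f x y" for x y
    proof -
      have "Y (\<lambda>m. c * x m) s = c * Y x s" for s
        by (simp add: Y_def sum_distrib_left mult_ac)
      then show ?thesis by (simp add: f_def sum_distrib_left mult_ac)
    qed
    have f_sym: "f x y = f y x" for x y by (simp add: f_def mult_ac)
    define u' where "u' = u(k := \<lambda>m. c * v m)"
    have "f (u' i) (u' j) = (if i = j then 1 else 0)" if "i < Suc k" "j < Suc k" for i j
    proof -
      have ff: "f (\<lambda>m. c * v m) (\<lambda>m. c * v m) = 1"
        by (subst f_scale, subst f_sym, subst f_scale) (use c in \<open>simp add: mult.assoc\<close>)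
      have fu: "f (\<lambda>m. c * v m) (u j) = 0" "f (u j) (\<lambda>m. c * v m) = 0" if "j < k" for j
        using orth[OF that] by (simp_all add: f_sym[of "u j"] f_scale)
      show ?thesis using that u(3) fu ff
        by (auto simp: u'_def less_Suc_eq)
    qed
    moreover have "0 < u' i i" "\<forall>m. i < m \<longrightarrow> u' i m = 0" if "i < Suc k" for i
      using that u(1,2) vk vb c by (auto simp: u'_def less_Suc_eq)
    ultimately show ?case by (intro exI[of _ u']) auto
  qed simp
  from this[OF order_refl] obtain u where u: "\<And>i. i < n \<Longrightarrow> 0 < u i i" "\<And>i m. i < n \<Longrightarrow> i < m \<Longrightarrow> u i m = 0"
      "\<And>i j. i < n \<Longrightarrow> j < n \<Longrightarrow> f (u i) (u j) = (if i = j then 1 else 0)"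
    by (metis (no_types))
  define U where "U = mat n n (\<lambda>(m, i). u i m)"
  have Uc: "U \<in> carrier_mat n n" by (simp add: U_def)
  have LU: "(L * U) $$ (s, i) = Y (u i) s" if "s < n" "i < n" for s i
    using that unfolding mult_entry[OF Lc Uc that] Y_def by (auto simp: U_def intro!: sum.cong)
  have "(L * U)\<^sup>T * (L * U) = 1\<^sub>m n"
  proof (rule eq_matI)
    fix i j assume "i < dim_row (1\<^sub>m n)" "j < dim_col (1\<^sub>m n)"
    then have ij: "i < n" "j < n" by auto
    have c: "L * U \<in> carrier_mat n n" using Lc Uc by simp
    have "((L * U)\<^sup>T * (L * U)) $$ (i, j) = (\<Sum>s<n. (L * U)\<^sup>T $$ (i, s) * (L * U) $$ (s, j))"
      using c ij by (intro mult_entry) auto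
    also have "\<dots> = f (u i) (u j)"
      unfolding f_def using ij Lc Uc LU by (intro sum.cong) (auto simp del: index_mult_mat(1))
    finally show "((L * U)\<^sup>T * (L * U)) $$ (i, j) = 1\<^sub>m n $$ (i, j)" using u(3) ij by simp
  qed (use Lc Uc in auto)
  then show ?thesis using u(1,2) by (intro exI[of _ U]) (auto simp: upper_tri_def U_def)
qed

section \<open>Eigenvectors of bidiagonal matrices\<close>

definition beta_prod :: "real vec \<Rightarrow> nat \<Rightarrow> nat \<Rightarrow> real" where
  "beta_prod \<beta> i j = (\<Prod>m = i..<j. \<beta> $ m)"

lemma beta_prod_refl [simp]: "beta_prod \<beta> i i = 1"
  by (simp add: beta_prod_def)

lemma beta_prod_trans: "i \<le> j \<Longrightarrow> j \<le> k \<Longrightarrow> beta_prod \<beta> i j * beta_prod \<beta> j k = beta_prod \<beta> i k"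
  by (simp add: beta_prod_def prod.atLeastLessThan_concat)

lemma beta_prod_step: "i < j \<Longrightarrow> beta_prod \<beta> i j = \<beta> $ i * beta_prod \<beta> (Suc i) j"
  by (simp add: beta_prod_def prod.atLeast_Suc_lessThan)

lemma beta_prod_Suc: "beta_prod \<beta> i (Suc i) = \<beta> $ i"
  by (simp add: beta_prod_def)

text \<open>
  The three values of \<open>k\<close> that matter: \<open>k = 1\<close> gives $B_\pi$, \<open>k = 2\<close> gives $B_{\pi,2}$, and
  \<open>k = 0\<close> gives ones on the subdiagonal (also where \<open>\<beta>\<close> vanishes).
\<close>
definition bidiag :: "nat \<Rightarrow> (nat \<Rightarrow> real) \<Rightarrow> real vec \<Rightarrow> nat \<Rightarrow> real mat" where
  "bidiag n \<mu> \<beta> k = mat n n (\<lambda>(i, j). if i = j then \<mu> i else if i = j + 1 then (\<beta> $ j) ^ k else 0)"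

lemma B2_aux_bidiag: "B2_aux n \<mu> \<beta> = bidiag n \<mu> \<beta> 2"
  by (simp add: B2_aux_def bidiag_def)

lemma bidiag_carrier [simp]: "bidiag n \<mu> \<beta> k \<in> carrier_mat n n"
  by (simp add: bidiag_def)

lemma sum_adjacent_pair:
  fixes f :: "nat \<Rightarrow> real"
  assumes "j < n" and "\<And>m. m < n \<Longrightarrow> m \<noteq> j \<Longrightarrow> m \<noteq> Suc j \<Longrightarrow> f m = 0"
  shows "(\<Sum>m<n. f m) = f j + (if Suc j < n then f (Suc j) else 0)"
proof -
  have "(\<Sum>m<n. f m) = (\<Sum>m\<in>(if Suc j < n then {j, Suc j} else {j}). f m)"
    using assms by (intro sum.mono_neutral_right) auto
  then show ?thesis by simp
qed

lemma mult_bidiag_entry: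
  assumes "A \<in> carrier_mat n n" "i < n" "j < n"
  shows "(A * bidiag n \<mu> \<beta> k) $$ (i, j) =
    A $$ (i, j) * \<mu> j + (if Suc j < n then A $$ (i, Suc j) * (\<beta> $ j) ^ k else 0)"
  using assms unfolding mult_entry[OF assms(1) bidiag_carrier assms(2,3)]
  by (subst sum_adjacent_pair[of j]) (auto simp: bidiag_def)

lemma bidiag_transpose_mult_vec:
  assumes "v \<in> carrier_vec n" "j < n"
  shows "((bidiag n \<mu> \<beta> k)\<^sup>T *\<^sub>v v) $ j = \<mu> j * v $ j + (if Suc j < n then (\<beta> $ j) ^ k * v $ Suc j else 0)"
proof -
  have "((bidiag n \<mu> \<beta> k)\<^sup>T *\<^sub>v v) $ j = (\<Sum>m<n. bidiag n \<mu> \<beta> k $$ (m, j) * v $ m)"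
    using assms by (auto simp: scalar_prod_def atLeast0LessThan bidiag_def intro!: sum.cong)
  also have "\<dots> = \<mu> j * v $ j + (if Suc j < n then (\<beta> $ j) ^ k * v $ Suc j else 0)"
    using assms by (subst sum_adjacent_pair[of j]) (auto simp: bidiag_def)
  finally show ?thesis .
qed

lemma bidiag_mult_vec:
  assumes "v \<in> carrier_vec n" "i < n"
  shows "(bidiag n \<mu> \<beta> k *\<^sub>v v) $ i = \<mu> i * v $ i + (if 0 < i then (\<beta> $ (i - 1)) ^ k * v $ (i - 1) else 0)"
proof -
  have "(bidiag n \<mu> \<beta> k *\<^sub>v v) $ i = (\<Sum>m<n. bidiag n \<mu> \<beta> k $$ (i, m) * v $ m)"
    using assms by (auto simp: scalar_prod_def atLeast0LessThan bidiag_def intro!: sum.cong)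
  also have "\<dots> = (\<Sum>m\<in>(if 0 < i then {i, i - 1} else {i}). bidiag n \<mu> \<beta> k $$ (i, m) * v $ m)"
    using assms by (intro sum.mono_neutral_right) (auto simp: bidiag_def)
  also have "\<dots> = \<mu> i * v $ i + (if 0 < i then (\<beta> $ (i - 1)) ^ k * v $ (i - 1) else 0)"
    using assms by (auto simp: bidiag_def)
  finally show ?thesis .
qed

lemma L_aux_carrier [simp]: "L_aux n \<mu> \<beta> k \<in> carrier_mat n n"
  by (simp add: L_aux_def)

lemma L_aux_dims [simp]: "dim_row (L_aux n \<mu> \<beta> k) = n" "dim_col (L_aux n \<mu> \<beta> k) = n"
  by (simp_all add: L_aux_def)

lemma L_aux_upper: "i < j \<Longrightarrow> j < n \<Longrightarrow> L_aux n \<mu> \<beta> k $$ (i, j) = 0"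
  by (simp add: L_aux_def)

lemma L_aux_diag: "i < n \<Longrightarrow> L_aux n \<mu> \<beta> k $$ (i, i) = 1"
  by (simp add: L_aux_def)

lemma L_aux_lower:
  "j \<le> i \<Longrightarrow> i < n \<Longrightarrow> L_aux n \<mu> \<beta> k $$ (i, j) = beta_prod \<beta> j i ^ k / (\<Prod>m = j..<i. \<mu> i - \<mu> m)"
  by (auto simp: L_aux_def beta_prod_def)

text \<open>
  This holds above the diagonal as well, since both entries vanish there, and so the sums that
  follow can be treated without distinguishing cases.
\<close>
lemma L_aux_power:
  "i < n \<Longrightarrow> j < n \<Longrightarrow> L_aux n \<mu> \<beta> k $$ (i, j) = beta_prod \<beta> j i ^ k * L_aux n \<mu> \<beta> 0 $$ (i, j)"
  by (auto simp: L_aux_def beta_prod_def)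

lemma L_aux_unipotent: "lower_unipotent n (L_aux n \<mu> \<beta> k)"
  by (simp add: lower_unipotent_def L_aux_upper L_aux_diag)

lemma lower_unipotent_tri: "lower_unipotent n L \<Longrightarrow> lower_tri n L"
  by (simp add: lower_unipotent_def lower_tri_def)

lemma diag_mult_L_aux:
  assumes "inj_on \<mu> {..<n}"
  shows "diag_of n \<mu> * L_aux n \<mu> \<beta> k = L_aux n \<mu> \<beta> k * bidiag n \<mu> \<beta> k"
proof (rule eq_matI)
  fix i j assume "i < dim_row (L_aux n \<mu> \<beta> k * bidiag n \<mu> \<beta> k)" "j < dim_col (L_aux n \<mu> \<beta> k * bidiag n \<mu> \<beta> k)"
  then have ij: "i < n" "j < n" by (auto simp: L_aux_def bidiag_def)
  let ?L = "L_aux n \<mu> \<beta> k"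
  have "\<mu> i * ?L $$ (i, j) = ?L $$ (i, j) * \<mu> j + (if Suc j < n then ?L $$ (i, Suc j) * (\<beta> $ j) ^ k else 0)"
  proof (cases "j < i")
    case True
    then have ne: "\<mu> i - \<mu> j \<noteq> 0" using assms ij by (auto dest: inj_onD)
    have "?L $$ (i, j) * (\<mu> i - \<mu> j) = ?L $$ (i, Suc j) * (\<beta> $ j) ^ k"
      using True ij ne by (simp add: L_aux_lower prod.atLeast_Suc_lessThan beta_prod_step power_mult_distrib)
    then show ?thesis using True ij by (simp add: algebra_simps)
  next
    case False
    then show ?thesis using ij by (cases "i = j") (auto simp: L_aux_upper)
  qed
  then show "(diag_of n \<mu> * ?L) $$ (i, j) = (?L * bidiag n \<mu> \<beta> k) $$ (i, j)"
    using ij by (simp add: diag_of_mult_entry mult_bidiag_entry del: index_mult_mat(1))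
qed (auto simp: L_aux_def bidiag_def diag_of_def)

text \<open>
  In each row the equation is a recursion that runs from the diagonal to the left; it can be
  solved since the \<open>\<mu>\<close> are distinct.
\<close>
lemma eigenvector_matrix_unique:
  assumes inj: "inj_on \<mu> {..<n}" and L: "lower_unipotent n L"
    and eq: "diag_of n \<mu> * L = L * bidiag n \<mu> \<beta> 1"
  shows "L = L_aux n \<mu> \<beta> 1"
proof -
  have Lc: "L \<in> carrier_mat n n" using L by (simp add: lower_unipotent_def)
  have rec: "M $$ (i, j) * (\<mu> i - \<mu> j) = M $$ (i, Suc j) * \<beta> $ j"
    if M: "M \<in> carrier_mat n n" "diag_of n \<mu> * M = M * bidiag n \<mu> \<beta> 1" and ij: "j < i" "i < n" for M i j
    using arg_cong[OF M(2), of "\<lambda>M. M $$ (i, j)"] M(1) ij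
    by (simp add: diag_of_mult_entry mult_bidiag_entry algebra_simps del: index_mult_mat(1))
  have *: "L $$ (i, j) = L_aux n \<mu> \<beta> 1 $$ (i, j)" if "j \<le> i" "i < n" for i j
    using that
  proof (induction "i - j" arbitrary: j)
    case 0
    then show ?case using L by (simp add: L_aux_diag lower_unipotent_def)
  next
    case (Suc d)
    then have j: "j < i" and IH: "L $$ (i, Suc j) = L_aux n \<mu> \<beta> 1 $$ (i, Suc j)" by auto
    have ne: "\<mu> i - \<mu> j \<noteq> 0" using inj j Suc.prems by (auto dest: inj_onD)
    have "L $$ (i, j) * (\<mu> i - \<mu> j) = L_aux n \<mu> \<beta> 1 $$ (i, j) * (\<mu> i - \<mu> j)"
      using rec[OF Lc eq j Suc.prems(2)] rec[OF _ diag_mult_L_aux[OF inj] j Suc.prems(2)] IH by simp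
    then show ?case using ne by simp
  qed
  show ?thesis
  proof (rule eq_matI)
    fix i j assume "i < dim_row (L_aux n \<mu> \<beta> 1)" "j < dim_col (L_aux n \<mu> \<beta> 1)"
    then have "i < n" "j < n" by (auto simp: L_aux_def)
    then show "L $$ (i, j) = L_aux n \<mu> \<beta> 1 $$ (i, j)"
      using * L by (cases "j \<le> i") (auto simp: L_aux_upper lower_unipotent_def)
  qed (use Lc in \<open>auto simp: L_aux_def\<close>)
qed

section \<open>The Gram matrix and its twist\<close>

definition gram_mat :: "nat \<Rightarrow> (nat \<Rightarrow> real) \<Rightarrow> real vec \<Rightarrow> real mat" where
  "gram_mat n \<mu> \<beta> = (L_aux n \<mu> \<beta> 1)\<^sup>T * L_aux n \<mu> \<beta> 1"

text \<open>
  If \<open>P\<close> is diagonal with entries \<open>beta_prod \<beta> 0 i\<close>, all nonzero, this is the conjugate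
  \<open>P\<^sup>-\<^sup>1 G P\<close> of the Gram matrix \<open>G\<close>, since \<open>L\<^sub>k = P\<^sup>k L\<^sub>0 P\<^sup>-\<^sup>k\<close>. Its first column is the
  starting vector of the algorithm.
\<close>
definition twisted_gram_mat :: "nat \<Rightarrow> (nat \<Rightarrow> real) \<Rightarrow> real vec \<Rightarrow> real mat" where
  "twisted_gram_mat n \<mu> \<beta> = (L_aux n \<mu> \<beta> 2)\<^sup>T * L_aux n \<mu> \<beta> 0"

lemma gram_mat_carrier [simp]: "gram_mat n \<mu> \<beta> \<in> carrier_mat n n" "twisted_gram_mat n \<mu> \<beta> \<in> carrier_mat n n"
  unfolding gram_mat_def twisted_gram_mat_def by (auto intro!: mult_carrier_mat[of _ n n])

lemma gram_mat_entry: "i < n \<Longrightarrow> j < n \<Longrightarrow> gram_mat n \<mu> \<beta> $$ (i, j) =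
    (\<Sum>s<n. beta_prod \<beta> i s * beta_prod \<beta> j s * (L_aux n \<mu> \<beta> 0 $$ (s, i) * L_aux n \<mu> \<beta> 0 $$ (s, j)))"
proof -
  assume ij: "i < n" "j < n"
  let ?L = "L_aux n \<mu> \<beta> 1"
  have "gram_mat n \<mu> \<beta> $$ (i, j) = (\<Sum>s<n. ?L $$ (s, i) * ?L $$ (s, j))"
    using ij unfolding gram_mat_def by (subst mult_entry[where n = n]) auto
  also have "\<dots> = (\<Sum>s<n. beta_prod \<beta> i s * beta_prod \<beta> j s * (L_aux n \<mu> \<beta> 0 $$ (s, i) * L_aux n \<mu> \<beta> 0 $$ (s, j)))"
  proof (rule sum.cong)
    fix s assume "s \<in> {..<n}"
    then have s: "s < n" by simp
    show "?L $$ (s, i) * ?L $$ (s, j) =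
      beta_prod \<beta> i s * beta_prod \<beta> j s * (L_aux n \<mu> \<beta> 0 $$ (s, i) * L_aux n \<mu> \<beta> 0 $$ (s, j))"
      unfolding L_aux_power[OF s ij(1), of \<mu> \<beta> 1] L_aux_power[OF s ij(2), of \<mu> \<beta> 1] by (simp add: mult_ac)
  qed simp
  finally show ?thesis .
qed

lemma twisted_gram_mat_entry: "i < n \<Longrightarrow> j < n \<Longrightarrow> twisted_gram_mat n \<mu> \<beta> $$ (i, j) =
    (\<Sum>s<n. (beta_prod \<beta> i s)\<^sup>2 * (L_aux n \<mu> \<beta> 0 $$ (s, i) * L_aux n \<mu> \<beta> 0 $$ (s, j)))"
proof -
  assume ij: "i < n" "j < n"
  have "twisted_gram_mat n \<mu> \<beta> $$ (i, j) = (\<Sum>s<n. L_aux n \<mu> \<beta> 2 $$ (s, i) * L_aux n \<mu> \<beta> 0 $$ (s, j))"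
    using ij unfolding twisted_gram_mat_def by (subst mult_entry[where n = n]) auto
  also have "\<dots> = (\<Sum>s<n. (beta_prod \<beta> i s)\<^sup>2 * (L_aux n \<mu> \<beta> 0 $$ (s, i) * L_aux n \<mu> \<beta> 0 $$ (s, j)))"
  proof (rule sum.cong)
    fix s assume "s \<in> {..<n}"
    then have s: "s < n" by simp
    show "L_aux n \<mu> \<beta> 2 $$ (s, i) * L_aux n \<mu> \<beta> 0 $$ (s, j) =
      (beta_prod \<beta> i s)\<^sup>2 * (L_aux n \<mu> \<beta> 0 $$ (s, i) * L_aux n \<mu> \<beta> 0 $$ (s, j))"
      unfolding L_aux_power[OF s ij(1), of \<mu> \<beta> 2] by (simp add: mult_ac)
  qed simp
  finally show ?thesis .
qed

text \<open>
  This lemma and the next one express the conjugation \<open>H = P\<^sup>-\<^sup>1 G P\<close> without dividing by any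
  \<open>\<beta>\<close>: the quotient of two entries of \<open>P\<close> is a product of consecutive \<open>\<beta>\<close>, and it is written on
  the side on which it is a numerator. Below the diagonal \<open>H\<close> carries more information than \<open>G\<close>.
\<close>
lemma twisted_gram_mat_lower:
  assumes "j \<le> i" "i < n"
  shows "beta_prod \<beta> j i * twisted_gram_mat n \<mu> \<beta> $$ (i, j) = gram_mat n \<mu> \<beta> $$ (i, j)"
proof -
  have "beta_prod \<beta> j i * ((beta_prod \<beta> i s)\<^sup>2 * (L_aux n \<mu> \<beta> 0 $$ (s, i) * L_aux n \<mu> \<beta> 0 $$ (s, j))) =
    beta_prod \<beta> i s * beta_prod \<beta> j s * (L_aux n \<mu> \<beta> 0 $$ (s, i) * L_aux n \<mu> \<beta> 0 $$ (s, j))" if "s < n" for s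
  proof (cases "i \<le> s")
    case True
    then show ?thesis using assms beta_prod_trans[of j i s \<beta>, symmetric] by (simp add: power2_eq_square)
  qed (use assms that in \<open>simp add: L_aux_upper\<close>)
  then have "(\<Sum>s<n. beta_prod \<beta> j i * ((beta_prod \<beta> i s)\<^sup>2 * (L_aux n \<mu> \<beta> 0 $$ (s, i) * L_aux n \<mu> \<beta> 0 $$ (s, j)))) =
    (\<Sum>s<n. beta_prod \<beta> i s * beta_prod \<beta> j s * (L_aux n \<mu> \<beta> 0 $$ (s, i) * L_aux n \<mu> \<beta> 0 $$ (s, j)))"
    by (intro sum.cong refl) simp
  moreover have "j < n" using assms by simp
  ultimately show ?thesis using assms by (simp only: gram_mat_entry twisted_gram_mat_entry sum_distrib_left)
qed

lemma twisted_gram_mat_upper: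
  assumes "i \<le> j" "j < n"
  shows "twisted_gram_mat n \<mu> \<beta> $$ (i, j) = beta_prod \<beta> i j * gram_mat n \<mu> \<beta> $$ (i, j)"
proof -
  have "(beta_prod \<beta> i s)\<^sup>2 * (L_aux n \<mu> \<beta> 0 $$ (s, i) * L_aux n \<mu> \<beta> 0 $$ (s, j)) =
    beta_prod \<beta> i j * (beta_prod \<beta> i s * beta_prod \<beta> j s * (L_aux n \<mu> \<beta> 0 $$ (s, i) * L_aux n \<mu> \<beta> 0 $$ (s, j)))" if "s < n" for s
  proof (cases "j \<le> s")
    case True
    then show ?thesis using assms beta_prod_trans[of i j s \<beta>, symmetric] by (simp add: power2_eq_square)
  qed (use assms that in \<open>simp add: L_aux_upper\<close>)
  then have "(\<Sum>s<n. (beta_prod \<beta> i s)\<^sup>2 * (L_aux n \<mu> \<beta> 0 $$ (s, i) * L_aux n \<mu> \<beta> 0 $$ (s, j))) =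
    (\<Sum>s<n. beta_prod \<beta> i j * (beta_prod \<beta> i s * beta_prod \<beta> j s * (L_aux n \<mu> \<beta> 0 $$ (s, i) * L_aux n \<mu> \<beta> 0 $$ (s, j))))"
    by (intro sum.cong refl) simp
  moreover have "i < n" using assms by simp
  ultimately show ?thesis using assms by (simp only: gram_mat_entry twisted_gram_mat_entry sum_distrib_left)
qed

text \<open>
  The matrix \<open>L\<^sub>2\<^sup>T M L\<^sub>0\<close> computed in two ways.
\<close>
lemma twisted_gram_mat_intertwines:
  assumes "inj_on \<mu> {..<n}"
  shows "(bidiag n \<mu> \<beta> 2)\<^sup>T * twisted_gram_mat n \<mu> \<beta> = twisted_gram_mat n \<mu> \<beta> * bidiag n \<mu> \<beta> 0"
proof -
  let ?L = "L_aux n \<mu> \<beta>" and ?B = "bidiag n \<mu> \<beta>" and ?M = "diag_of n \<mu>"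
  have Mt: "?M\<^sup>T = ?M" by (auto simp: diag_of_def)
  have a: "A * B * C = A * (B * C)" if "A \<in> carrier_mat n n" "B \<in> carrier_mat n n" "C \<in> carrier_mat n n" for A B C :: "real mat"
    using that by (rule assoc_mult_mat)
  have "(?B 2)\<^sup>T * twisted_gram_mat n \<mu> \<beta> = (?B 2)\<^sup>T * (?L 2)\<^sup>T * ?L 0" by (simp add: twisted_gram_mat_def a)
  also have "(?B 2)\<^sup>T * (?L 2)\<^sup>T = (?L 2 * ?B 2)\<^sup>T"
    by (rule transpose_mult[symmetric, OF L_aux_carrier bidiag_carrier])
  also have "\<dots> = (?M * ?L 2)\<^sup>T" by (simp add: diag_mult_L_aux[OF assms])
  also have "\<dots> = (?L 2)\<^sup>T * ?M" using transpose_mult[of ?M n n "?L 2" n] by (simp add: Mt)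
  also have "\<dots> * ?L 0 = (?L 2)\<^sup>T * (?L 0 * ?B 0)" by (simp add: a diag_mult_L_aux[OF assms])
  also have "\<dots> = twisted_gram_mat n \<mu> \<beta> * ?B 0" by (simp add: twisted_gram_mat_def a)
  finally show ?thesis .
qed

section \<open>The algorithm computes the tridiagonal matrix\<close>

text \<open>
  The data extracted from a matrix with bidiagonal coordinates \<open>\<beta>\<close>. Nothing else about \<open>U\<close> is
  assumed, so the locale can be interpreted both with the \<open>U\<close> that Gram-Schmidt provides and with
  the one that belongs to an arbitrary competitor.
\<close>
locale triangular_orthogonalizer =
  fixes n :: nat and \<mu> :: "nat \<Rightarrow> real" and \<beta> :: "real vec" and U :: "real mat"
  assumes inj: "inj_on \<mu> {..<n}"
    and U: "upper_tri n U"
    and U_pos: "i < n \<Longrightarrow> 0 < U $$ (i, i)"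
    and orth: "(L_aux n \<mu> \<beta> 1 * U)\<^sup>T * (L_aux n \<mu> \<beta> 1 * U) = 1\<^sub>m n"
begin

abbreviation "L \<equiv> L_aux n \<mu> \<beta> 1"
abbreviation "M \<equiv> diag_of n \<mu>"
abbreviation "B \<equiv> bidiag n \<mu> \<beta> 1"
definition "Q = L * U"
definition "F = L\<^sup>T * Q"
definition "T = Q\<^sup>T * M * Q"

lemma carriers [simp]: "U \<in> carrier_mat n n" "Q \<in> carrier_mat n n" "F \<in> carrier_mat n n" "T \<in> carrier_mat n n"
proof -
  show U: "U \<in> carrier_mat n n" using U by (simp add: upper_tri_def)
  show Q: "Q \<in> carrier_mat n n" using U unfolding Q_def by (auto intro: mult_carrier_mat[of _ n n])
  show "F \<in> carrier_mat n n" using Q unfolding F_def by (auto intro: mult_carrier_mat[of _ n n])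
  have "Q\<^sup>T * M \<in> carrier_mat n n" using Q by (auto intro: mult_carrier_mat[of _ n n])
  then show "T \<in> carrier_mat n n" using Q unfolding T_def by (rule mult_carrier_mat)
qed

lemma transpose_carriers [simp]: "U\<^sup>T \<in> carrier_mat n n" "Q\<^sup>T \<in> carrier_mat n n" "F\<^sup>T \<in> carrier_mat n n" "L\<^sup>T \<in> carrier_mat n n"
  by simp_all

lemma dims [simp]: "dim_row U = n" "dim_col U = n" "dim_row F = n" "dim_col F = n"
  "dim_row T = n" "dim_col T = n" "dim_row (twisted_gram_mat n \<mu> \<beta>) = n"
  using carriers(1,3,4) gram_mat_carrier(2)[of n \<mu> \<beta>] by blast+

lemma QtQ: "Q\<^sup>T * Q = 1\<^sub>m n" and QQt: "Q * Q\<^sup>T = 1\<^sub>m n"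
proof -
  show 1: "Q\<^sup>T * Q = 1\<^sub>m n" using orth by (simp add: Q_def)
  show "Q * Q\<^sup>T = 1\<^sub>m n" using mat_mult_left_right_inverse[OF _ _ 1] by simp
qed

lemma UtF: "U\<^sup>T * F = 1\<^sub>m n"
proof -
  have "Q\<^sup>T = U\<^sup>T * L\<^sup>T" unfolding Q_def by (rule transpose_mult[of _ n n _ n]) auto
  then show ?thesis using QtQ by (simp add: F_def assoc_mult_mat[of _ n n _ n _ n])
qed

lemma FtU: "F\<^sup>T * U = 1\<^sub>m n"
proof -
  have "(U\<^sup>T * F)\<^sup>T = F\<^sup>T * U\<^sup>T\<^sup>T" by (rule transpose_mult[of _ n n _ n]) auto
  then show ?thesis by (simp add: UtF)
qed

lemma F_lower: "lower_tri n F" and F_diag: "i < n \<Longrightarrow> U $$ (i, i) * F $$ (i, i) = 1"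
proof -
  have Ut: "lower_tri n U\<^sup>T" using upper_tri_transpose[of n "U\<^sup>T"] U by simp
  have d: "U\<^sup>T $$ (i, i) = U $$ (i, i)" if "i < n" for i using that by simp
  show F: "lower_tri n F"
  proof (rule lower_tri_cancel_left[OF Ut])
    show "U\<^sup>T $$ (i, i) \<noteq> 0" if "i < n" for i using U_pos[OF that] d[OF that] by simp
  qed (auto simp: UtF, simp add: lower_tri_def)
  assume "i < n"
  then show "U $$ (i, i) * F $$ (i, i) = 1"
    using lower_tri_mult(2)[OF Ut F, of i] by (simp add: UtF d)
qed

lemma F_pos: "i < n \<Longrightarrow> 0 < F $$ (i, i)"
  by (rule zero_less_mult_pos[of "U $$ (i, i)"]) (simp_all add: F_diag U_pos)

lemma F_zero: "i < j \<Longrightarrow> j < n \<Longrightarrow> F $$ (i, j) = 0"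
  using F_lower by (simp add: lower_tri_def)

lemma U_zero: "j < i \<Longrightarrow> i < n \<Longrightarrow> U $$ (i, j) = 0"
  using U by (simp add: upper_tri_def)

lemma gram_mat_mult_U: "gram_mat n \<mu> \<beta> * U = F"
  by (simp add: gram_mat_def F_def Q_def assoc_mult_mat[of _ n n _ n _ n])

lemma T_intertwines: "T * F\<^sup>T = F\<^sup>T * B"
proof -
  have "F\<^sup>T = Q\<^sup>T * L\<^sup>T\<^sup>T" unfolding F_def by (rule transpose_mult[of _ n n _ n]) auto
  then have Ft: "F\<^sup>T = Q\<^sup>T * L" by simp
  have "T * F\<^sup>T = Q\<^sup>T * (M * (Q * (Q\<^sup>T * L)))"
    by (simp add: Ft T_def assoc_mult_mat[of _ n n _ n _ n])
  also have "Q * (Q\<^sup>T * L) = L" by (rule mult_inverse_cancel[OF QQt]) auto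
  also have "Q\<^sup>T * (M * L) = F\<^sup>T * B"
    unfolding diag_mult_L_aux[OF inj] Ft by (simp add: assoc_mult_mat[of _ n n _ n _ n])
  finally show ?thesis .
qed

lemma T_sym: "T\<^sup>T = T"
proof -
  have Mt: "M\<^sup>T = M" by (auto simp: diag_of_def)
  have "(Q\<^sup>T * M * Q)\<^sup>T = Q\<^sup>T * (Q\<^sup>T * M)\<^sup>T" by (rule transpose_mult[of _ n n _ n]) auto
  also have "(Q\<^sup>T * M)\<^sup>T = M\<^sup>T * Q\<^sup>T\<^sup>T" by (rule transpose_mult[of _ n n _ n]) auto
  finally show ?thesis by (simp add: T_def Mt assoc_mult_mat[of _ n n _ n _ n])
qed

lemma T_sym_entry: "i < n \<Longrightarrow> j < n \<Longrightarrow> T $$ (i, j) = T $$ (j, i)"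
  by (metis T_sym dims(5,6) index_transpose_mat(1))

lemma T_tridiagonal: "sym_tridiagonal n T"
proof -
  have "upper_tri n F\<^sup>T" using F_lower upper_tri_transpose by blast
  moreover have "upper_hess n B" by (auto simp: upper_hess_def bidiag_def)
  ultimately have "upper_hess n (F\<^sup>T * B * U)" using U upper_hess_mult by blast
  moreover have "F\<^sup>T * B * U = T"
    unfolding T_intertwines[symmetric] by (simp add: assoc_mult_mat[of _ n n _ n _ n] FtU)
  ultimately have "upper_hess n T" by (simp only:)
  then have lo: "T $$ (i, j) = 0" if "i < n" "j < n" "j + 1 < i" for i j
    using that by (simp add: upper_hess_def)
  have "T $$ (i, j) = 0" if "i < n" "j < n" "i + 1 < j" for i j
    using lo[OF that(2,1,3)] T_sym_entry[OF that(1,2)] by simp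
  with lo show ?thesis using T_sym by (auto simp: sym_tridiagonal_def)
qed

lemma T_zero: "i < n \<Longrightarrow> j < n \<Longrightarrow> i + 1 < j \<or> j + 1 < i \<Longrightarrow> T $$ (i, j) = 0"
  using T_tridiagonal unfolding sym_tridiagonal_def by blast

lemma TFt_entry:
  assumes "i < n" "k < n"
  shows "(\<Sum>m<n. T $$ (i, m) * F $$ (k, m)) = F $$ (k, i) * \<mu> k + (if Suc k < n then F $$ (Suc k, i) * \<beta> $ k else 0)"
proof -
  have "(T * F\<^sup>T) $$ (i, k) = (\<Sum>m<n. T $$ (i, m) * F\<^sup>T $$ (m, k))"
    using assms by (intro mult_entry) auto
  also have "\<dots> = (\<Sum>m<n. T $$ (i, m) * F $$ (k, m))"
    using assms by (intro sum.cong) auto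
  finally have "(\<Sum>m<n. T $$ (i, m) * F $$ (k, m)) = (F\<^sup>T * B) $$ (i, k)" by (simp only: T_intertwines)
  also have "\<dots> = F $$ (k, i) * \<mu> k + (if Suc k < n then F $$ (Suc k, i) * \<beta> $ k else 0)"
    using assms by (subst mult_bidiag_entry) auto
  finally show ?thesis by simp
qed

lemma T_subdiag:
  assumes "Suc k < n"
  shows "T $$ (Suc k, k) * F $$ (k, k) = \<beta> $ k * F $$ (Suc k, Suc k)"
proof -
  have "(\<Sum>m<n. T $$ (Suc k, m) * F $$ (k, m)) = (\<Sum>m\<in>{k}. T $$ (Suc k, m) * F $$ (k, m))"
  proof (rule sum.mono_neutral_right)
    show "\<forall>m\<in>{..<n} - {k}. T $$ (Suc k, m) * F $$ (k, m) = 0"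
    proof
      fix m assume m: "m \<in> {..<n} - {k}"
      then show "T $$ (Suc k, m) * F $$ (k, m) = 0"
        using assms by (cases "m < k") (auto simp: T_zero F_zero)
    qed
  qed (use assms in auto)
  then show ?thesis using TFt_entry[of "Suc k" k] assms F_zero[of k "Suc k"] by (simp add: mult.commute)
qed

lemma T_diag:
  assumes "k < n"
  shows "T $$ (k, k) * F $$ (k, k) + (if 0 < k then T $$ (k, k - 1) * F $$ (k, k - 1) else 0) =
    F $$ (k, k) * \<mu> k + (if Suc k < n then F $$ (Suc k, k) * \<beta> $ k else 0)"
proof -
  have "(\<Sum>m<n. T $$ (k, m) * F $$ (k, m)) =
    (\<Sum>m\<in>(if 0 < k then {k, k - 1} else {k}). T $$ (k, m) * F $$ (k, m))"
  proof (rule sum.mono_neutral_right)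
    show "\<forall>m\<in>{..<n} - (if 0 < k then {k, k - 1} else {k}). T $$ (k, m) * F $$ (k, m) = 0"
    proof
      fix m assume m: "m \<in> {..<n} - (if 0 < k then {k, k - 1} else {k})"
      then have "m + 1 < k \<or> k < m" by (auto split: if_splits)
      then show "T $$ (k, m) * F $$ (k, m) = 0"
        using assms m by (auto simp: T_zero F_zero)
    qed
  qed (use assms in \<open>auto split: if_splits\<close>)
  also have "\<dots> = T $$ (k, k) * F $$ (k, k) + (if 0 < k then T $$ (k, k - 1) * F $$ (k, k - 1) else 0)"
    by simp
  finally show ?thesis using TFt_entry[OF assms assms] by simp
qed

text \<open>
  The coefficients of the algorithm's vectors with respect to the columns of \<open>H\<close>. The factor
  \<open>F $$ (k, k)\<close> is the inverse of \<open>U $$ (k, k)\<close> and normalizes the last coefficient to 1.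
\<close>
definition coef :: "nat \<Rightarrow> real vec" where
  "coef k = vec n (\<lambda>i. if i \<le> k then beta_prod \<beta> i k * U $$ (i, k) * F $$ (k, k) else 0)"

text \<open>
  With indices from 0, \<open>rvec k\<close> is the vector $\tilde r_{k+1}$ of the algorithm.
\<close>
definition rvec :: "nat \<Rightarrow> real vec" where
  "rvec k = twisted_gram_mat n \<mu> \<beta> *\<^sub>v coef k"

lemma coef_rvec_carrier [simp]: "coef k \<in> carrier_vec n" "rvec k \<in> carrier_vec n" "dim_vec (rvec k) = n" "dim_vec (coef k) = n"
proof -
  show coef: "coef k \<in> carrier_vec n" by (simp add: coef_def)
  show "rvec k \<in> carrier_vec n" unfolding rvec_def by (rule mult_mat_vec_carrier[OF gram_mat_carrier(2) coef])
  then show "dim_vec (rvec k) = n" by simp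
  show "dim_vec (coef k) = n" by (simp add: coef_def)
qed

lemma coef_diag: "k < n \<Longrightarrow> coef k $ k = 1"
  by (simp add: coef_def F_diag)

lemma coef_zero: "k < i \<Longrightarrow> i < n \<Longrightarrow> coef k $ i = 0"
  by (simp add: coef_def)

lemma F_sum: "j < n \<Longrightarrow> k < n \<Longrightarrow> F $$ (j, k) = (\<Sum>i<n. gram_mat n \<mu> \<beta> $$ (j, i) * U $$ (i, k))"
  by (subst gram_mat_mult_U[symmetric], subst mult_entry[where n = n]) auto

lemma rvec_sum: "j < n \<Longrightarrow> rvec k $ j = (\<Sum>i<n. twisted_gram_mat n \<mu> \<beta> $$ (j, i) * coef k $ i)"
  unfolding rvec_def by (rule mult_vec_entry) auto

text \<open>
  The products of \<open>\<beta>\<close> in \<open>coef\<close> are exactly the factors that turn the entries of \<open>H\<close> in a row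
  \<open>j \<le> k\<close> into those of \<open>G\<close>; what is left is the product \<open>G U = F\<close>, which is lower triangular.
\<close>
lemma rvec_before:
  assumes "j \<le> k" "k < n"
  shows "rvec k $ j = beta_prod \<beta> j k * (F $$ (j, k) * F $$ (k, k))"
proof -
  have "rvec k $ j = (\<Sum>i<n. beta_prod \<beta> j k * F $$ (k, k) * (gram_mat n \<mu> \<beta> $$ (j, i) * U $$ (i, k)))"
    using assms unfolding rvec_sum[OF le_less_trans[OF assms]]
  proof (intro sum.cong refl)
    fix i assume "i \<in> {..<n}"
    then have i: "i < n" by simp
    consider "k < i" | "i \<le> j" | "j \<le> i" "i \<le> k" by linarith
    then show "twisted_gram_mat n \<mu> \<beta> $$ (j, i) * coef k $ i = beta_prod \<beta> j k * F $$ (k, k) * (gram_mat n \<mu> \<beta> $$ (j, i) * U $$ (i, k))"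
    proof cases
      case 1
      then show ?thesis using i by (simp add: coef_zero U_zero)
    next
      case 2
      then show ?thesis
        using i assms by (simp add: coef_def twisted_gram_mat_lower[symmetric] beta_prod_trans[of i j k \<beta>, symmetric])
    next
      case 3
      then show ?thesis
        using i assms by (simp add: coef_def twisted_gram_mat_upper beta_prod_trans[of j i k \<beta>, symmetric])
    qed
  qed
  then show ?thesis using assms by (simp add: F_sum[of j k] sum_distrib_left[symmetric])
qed

text \<open>
  The companion of \<open>rvec_before\<close> in the rows \<open>j \<ge> k\<close>. The algorithm's vector cannot be read off
  from \<open>F\<close> there when a \<open>\<beta>\<close> vanishes, but the product that enters the formulas for the output can.
\<close>
lemma rvec_after:
  assumes "k \<le> j" "j < n"
  shows "beta_prod \<beta> k j * rvec k $ j = F $$ (j, k) * F $$ (k, k)"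
proof -
  have "beta_prod \<beta> k j * rvec k $ j = (\<Sum>i<n. beta_prod \<beta> k j * (twisted_gram_mat n \<mu> \<beta> $$ (j, i) * coef k $ i))"
    using assms by (simp add: rvec_sum sum_distrib_left)
  also have "\<dots> = (\<Sum>i<n. F $$ (k, k) * (gram_mat n \<mu> \<beta> $$ (j, i) * U $$ (i, k)))"
  proof (intro sum.cong refl)
    fix i assume "i \<in> {..<n}"
    then have i: "i < n" by simp
    show "beta_prod \<beta> k j * (twisted_gram_mat n \<mu> \<beta> $$ (j, i) * coef k $ i) = F $$ (k, k) * (gram_mat n \<mu> \<beta> $$ (j, i) * U $$ (i, k))"
    proof (cases "i \<le> k")
      case True
      then show ?thesis
        using i assms by (simp add: coef_def twisted_gram_mat_lower[symmetric] beta_prod_trans[of i k j \<beta>, symmetric])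
    next
      case False
      then show ?thesis using i by (simp add: coef_zero U_zero)
    qed
  qed
  finally show ?thesis using assms by (simp add: F_sum[of j k] sum_distrib_left[symmetric])
qed

lemma rvec_zero: "j < k \<Longrightarrow> k < n \<Longrightarrow> rvec k $ j = 0"
  by (simp add: rvec_before F_zero)

lemma rvec_diag: "k < n \<Longrightarrow> rvec k $ k = (F $$ (k, k))\<^sup>2"
  by (simp add: rvec_before power2_eq_square)

lemma rvec_next: "Suc k < n \<Longrightarrow> \<beta> $ k * rvec k $ Suc k = F $$ (Suc k, k) * F $$ (k, k)"
  using rvec_after[of k "Suc k"] by (simp add: beta_prod_Suc)

text \<open>
  The leading \<open>k \<times> k\<close> block of \<open>H\<close> is invertible: subtracting multiples of the \<open>coef\<close> vectors
  removes the coordinates of \<open>u\<close> from the last to the first.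
\<close>
lemma twisted_gram_mat_leading_injective:
  assumes "k \<le> n" "u \<in> carrier_vec n" "\<And>i. k \<le> i \<Longrightarrow> i < n \<Longrightarrow> u $ i = 0"
    and "\<And>j. j < k \<Longrightarrow> (twisted_gram_mat n \<mu> \<beta> *\<^sub>v u) $ j = 0"
  shows "u = 0\<^sub>v n"
  using assms
proof (induction k arbitrary: u)
  case 0
  then show ?case by (intro eq_vecI) auto
next
  case (Suc k)
  let ?H = "twisted_gram_mat n \<mu> \<beta>"
  define v where "v = u - u $ k \<cdot>\<^sub>v coef k"
  have [simp]: "dim_vec u = n" using Suc.prems by simp
  have "?H *\<^sub>v v = ?H *\<^sub>v u - u $ k \<cdot>\<^sub>v rvec k"
    unfolding v_def rvec_def using Suc.prems(2)
    by (subst mult_minus_distrib_mat_vec[of _ n n]) (auto simp: mult_mat_vec[of _ n n])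
  then have Hv: "(?H *\<^sub>v v) $ j = (?H *\<^sub>v u) $ j - u $ k * rvec k $ j" if "j < n" for j
    using that by (simp del: index_mult_mat_vec)
  have "v = 0\<^sub>v n"
  proof (rule Suc.IH)
    show "v $ i = 0" if "k \<le> i" "i < n" for i
      using that Suc.prems(3)[of i] coef_diag coef_zero by (cases "i = k") (auto simp: v_def)
    show "(?H *\<^sub>v v) $ j = 0" if "j < k" for j
      using that Suc.prems Hv[of j] rvec_zero[of j k] by (simp del: index_mult_mat_vec)
  qed (use Suc.prems in \<open>auto simp: v_def\<close>)
  have v: "u $ i = u $ k * coef k $ i" if "i < n" for i
    using that arg_cong[OF \<open>v = 0\<^sub>v n\<close>, of "\<lambda>v. v $ i"] by (simp add: v_def)
  from \<open>v = 0\<^sub>v n\<close> have "?H *\<^sub>v v = 0\<^sub>v n"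
    by (auto intro!: eq_vecI simp: mult_vec_entry[OF gram_mat_carrier(2)] simp del: index_mult_mat_vec)
  then have "u $ k * rvec k $ k = 0"
    using Hv[of k] Suc.prems by (simp del: index_mult_mat_vec)
  then have "u $ k = 0" using rvec_diag[of k] F_pos[of k] Suc.prems by simp
  with v show ?case by (intro eq_vecI) auto
qed

text \<open>
  \<open>offdiag k\<close> is $b_k$ of the algorithm; both it and \<open>rvec_prev\<close> incorporate the conventions
  $b_0 = 0$ and $\tilde r_0 = 0$.
\<close>
definition offdiag :: "nat \<Rightarrow> real" where
  "offdiag k = (if k = 0 then 0 else T $$ (k, k - 1))"

definition rvec_prev :: "nat \<Rightarrow> real vec" where
  "rvec_prev k = (if k = 0 then 0\<^sub>v n else rvec (k - 1))"

lemma rvec_prev_carrier [simp]: "rvec_prev k \<in> carrier_vec n" "dim_vec (rvec_prev k) = n"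
  by (simp_all add: rvec_prev_def)

lemma T_subdiag_ratio: "Suc k < n \<Longrightarrow> T $$ (Suc k, k) = \<beta> $ k * (F $$ (Suc k, Suc k) / F $$ (k, k))"
  using T_subdiag[of k] F_pos[of k] by (simp add: field_simps)

lemma offdiag_sqrt:
  assumes "Suc k < n"
  shows "\<beta> $ k * sqrt (rvec (Suc k) $ Suc k / rvec k $ k) = offdiag (Suc k)"
  using assms F_pos[of k] F_pos[of "Suc k"]
  by (simp add: offdiag_def T_subdiag_ratio rvec_diag real_sqrt_divide)

lemma offdiag_sq:
  assumes "k < n"
  shows "(offdiag k)\<^sup>2 * rvec_prev k $ k = (if 0 < k then T $$ (k, k - 1) * F $$ (k, k - 1) else 0) * F $$ (k, k)"
proof (cases k)
  case 0
  then show ?thesis using assms by (simp add: rvec_prev_def offdiag_def)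
next
  case (Suc m)
  have "(offdiag k)\<^sup>2 * rvec_prev k $ k = T $$ (k, m) * (F $$ (k, k) / F $$ (m, m)) * (\<beta> $ m * rvec m $ k)"
    using Suc assms T_subdiag_ratio[of m] by (simp add: rvec_prev_def offdiag_def power2_eq_square)
  also have "\<beta> $ m * rvec m $ k = F $$ (k, m) * F $$ (m, m)" using Suc assms rvec_next[of m] by simp
  finally show ?thesis using Suc assms F_pos[of m] by simp
qed

text \<open>
  The \<open>k\<close>-th diagonal entry of \<open>T F\<^sup>T = F\<^sup>T B\<^sub>1\<close>, multiplied by \<open>F $$ (k, k)\<close>.
\<close>
lemma diag_formula:
  assumes "k < n"
  shows "((bidiag n \<mu> \<beta> 2)\<^sup>T *\<^sub>v rvec k) $ k = (offdiag k)\<^sup>2 * rvec_prev k $ k + T $$ (k, k) * rvec k $ k"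
proof -
  let ?p = "if 0 < k then T $$ (k, k - 1) * F $$ (k, k - 1) else 0"
  have "((bidiag n \<mu> \<beta> 2)\<^sup>T *\<^sub>v rvec k) $ k = \<mu> k * rvec k $ k + (if Suc k < n then (\<beta> $ k)\<^sup>2 * rvec k $ Suc k else 0)"
    using assms by (intro bidiag_transpose_mult_vec) auto
  also have "\<dots> = (F $$ (k, k) * \<mu> k + (if Suc k < n then F $$ (Suc k, k) * \<beta> $ k else 0)) * F $$ (k, k)"
    using assms rvec_next[of k] by (auto simp: rvec_diag power2_eq_square algebra_simps)
  also have "\<dots> = (T $$ (k, k) * F $$ (k, k) + ?p) * F $$ (k, k)"
    using T_diag[OF assms] by (simp only:)
  finally show ?thesis unfolding offdiag_sq[OF assms] rvec_diag[OF assms]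
    by (simp only: algebra_simps power2_eq_square)
qed

text \<open>
  The right-hand side is, like the left-hand side, a combination of the columns \<open>0, \<dots>, k + 1\<close> of \<open>H\<close>
  in which the last has coefficient 1, because \<open>B\<^sub>0\<close> has ones on its subdiagonal. Its coordinates
  \<open>0, \<dots>, k\<close> vanish: coordinate \<open>k\<close> by the choice of the diagonal entry of \<open>T\<close>, coordinate \<open>k - 1\<close> by
  the choice of the off-diagonal entry. So the two sides agree.
\<close>
lemma rvec_recursion:
  assumes k: "Suc k < n"
  shows "rvec (Suc k) = (bidiag n \<mu> \<beta> 2)\<^sup>T *\<^sub>v rvec k - T $$ (k, k) \<cdot>\<^sub>v rvec k - (offdiag k)\<^sup>2 \<cdot>\<^sub>v rvec_prev k"
proof -
  let ?H = "twisted_gram_mat n \<mu> \<beta>" and ?B = "bidiag n \<mu> \<beta>"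
  define coef_prev where "coef_prev = (if k = 0 then 0\<^sub>v n else coef (k - 1))"
  define y where "y = (?B 2)\<^sup>T *\<^sub>v rvec k - T $$ (k, k) \<cdot>\<^sub>v rvec k - (offdiag k)\<^sup>2 \<cdot>\<^sub>v rvec_prev k"
  \<comment> \<open>the coefficients of the difference of the two sides with respect to the columns of \<open>H\<close>\<close>
  define u where "u = ?B 0 *\<^sub>v coef k - T $$ (k, k) \<cdot>\<^sub>v coef k - (offdiag k)\<^sup>2 \<cdot>\<^sub>v coef_prev - coef (Suc k)"
  have c [simp]: "coef_prev \<in> carrier_vec n" "?B 0 *\<^sub>v coef k \<in> carrier_vec n" "(?B 2)\<^sup>T *\<^sub>v rvec k \<in> carrier_vec n"
    by (auto simp: coef_prev_def intro!: mult_mat_vec_carrier[of _ n n])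
  then have uc: "u \<in> carrier_vec n" and yc: "y \<in> carrier_vec n" by (auto simp: u_def y_def)
  have [simp]: "dim_vec coef_prev = n" using c(1) by (rule carrier_vecD)
  have "?H *\<^sub>v coef_prev = rvec_prev k"
    by (auto simp: coef_prev_def rvec_prev_def rvec_def mult_vec_entry[OF gram_mat_carrier(2)] simp del: index_mult_mat_vec intro!: eq_vecI)
  moreover have "?H *\<^sub>v (?B 0 *\<^sub>v coef k) = (?B 2)\<^sup>T *\<^sub>v rvec k"
  proof -
    have "?H *\<^sub>v (?B 0 *\<^sub>v coef k) = (?H * ?B 0) *\<^sub>v coef k"
      by (rule assoc_mult_mat_vec[symmetric, of _ n n _ n]) auto
    also have "\<dots> = ((?B 2)\<^sup>T * ?H) *\<^sub>v coef k" by (simp only: twisted_gram_mat_intertwines[OF inj])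
    also have "\<dots> = (?B 2)\<^sup>T *\<^sub>v rvec k"
      unfolding rvec_def by (rule assoc_mult_mat_vec[of _ n n _ n]) auto
    finally show ?thesis .
  qed
  ultimately have Hu: "?H *\<^sub>v u = y - rvec (Suc k)"
    unfolding u_def y_def rvec_def using c
    by (simp add: mult_minus_distrib_mat_vec[of _ n n] mult_mat_vec[of _ n n])
  have "u = 0\<^sub>v n"
  proof (rule twisted_gram_mat_leading_injective[of "Suc k"])
    show "u $ i = 0" if i: "Suc k \<le> i" "i < n" for i
    proof -
      have "(?B 0 *\<^sub>v coef k) $ i = (if i = Suc k then 1 else 0)"
        using i k by (subst bidiag_mult_vec) (auto simp: coef_zero coef_diag)
      moreover have "coef k $ i = 0" "coef_prev $ i = 0" using i k by (auto simp: coef_zero coef_prev_def)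
      moreover have "coef (Suc k) $ i = (if i = Suc k then 1 else 0)" using i k by (auto simp: coef_zero coef_diag)
      ultimately show ?thesis using i by (simp add: u_def del: index_mult_mat_vec)
    qed
    show "(?H *\<^sub>v u) $ j = 0" if j: "j < Suc k" for j
    proof -
      have jn: "j < n" using j k by simp
      have e: "(?H *\<^sub>v u) $ j = ((?B 2)\<^sup>T *\<^sub>v rvec k) $ j - T $$ (k, k) * rvec k $ j - (offdiag k)\<^sup>2 * rvec_prev k $ j - rvec (Suc k) $ j"
        using j k by (simp add: Hu y_def del: index_mult_mat_vec)
      consider "j = k" | "Suc j < k" | "Suc j = k" using j by linarith
      then show ?thesis
      proof cases
        case 1
        then show ?thesis using e diag_formula[of k] k rvec_zero[of k "Suc k"] by simp
      next
        case 2
        then show ?thesis using e k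
          by (simp add: bidiag_transpose_mult_vec rvec_zero rvec_prev_def del: index_mult_mat_vec)
      next
        case 3
        then have "(offdiag k)\<^sup>2 * rvec_prev k $ j = (\<beta> $ j)\<^sup>2 * rvec k $ k"
          using k F_pos[of j] T_subdiag_ratio[of j]
          by (auto simp: offdiag_def rvec_prev_def rvec_diag power_mult_distrib power_divide)
        then show ?thesis using 3 e k
          by (auto simp: bidiag_transpose_mult_vec rvec_zero simp del: index_mult_mat_vec)
      qed
    qed
  qed (use k uc in auto)
  then have y0: "y - rvec (Suc k) = 0\<^sub>v n"
    unfolding Hu[symmetric]
    by (auto intro!: eq_vecI simp: mult_vec_entry[OF gram_mat_carrier(2)] simp del: index_mult_mat_vec)
  have "rvec (Suc k) $ i = y $ i" if "i < n" for i
    using that arg_cong[OF \<open>y - rvec (Suc k) = 0\<^sub>v n\<close>, of "\<lambda>v. v $ i"] yc by simp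
  then have "rvec (Suc k) = y" using yc by (intro eq_vecI) auto
  then show ?thesis by (simp only: y_def)
qed

lemma rvec_first: assumes "0 < n" shows "rvec 0 = alg_r n \<mu> \<beta> (Suc 0)"
proof -
  have "coef 0 = unit_vec n 0"
    using assms F_diag[of 0] by (intro eq_vecI) (auto simp: coef_def)
  then show ?thesis unfolding rvec_def twisted_gram_mat_def
    by (simp add: assoc_mult_mat_vec[of _ n n _ n])
qed

lemma algorithm_computes:
  assumes "k < n"
  shows "alg_r n \<mu> \<beta> k = rvec_prev k \<and> alg_r n \<mu> \<beta> (Suc k) = rvec k \<and>
    alg_b n \<mu> \<beta> k = offdiag k \<and> alg_a n \<mu> \<beta> (Suc k) = T $$ (k, k)"
  using assms
proof (induction k)
  have a: "alg_a n \<mu> \<beta> (Suc k) = T $$ (k, k)"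
    if "k < n" "alg_r n \<mu> \<beta> k = rvec_prev k" "alg_r n \<mu> \<beta> (Suc k) = rvec k" "alg_b n \<mu> \<beta> k = offdiag k" for k
  proof -
    have "rvec k $ k \<noteq> 0" using F_pos[of k] that(1) by (simp add: rvec_diag)
    moreover have "alg_a n \<mu> \<beta> (Suc k) = (((bidiag n \<mu> \<beta> 2)\<^sup>T *\<^sub>v rvec k) $ k
       - (offdiag k)\<^sup>2 * rvec_prev k $ k) / rvec k $ k"
      unfolding alg_a.simps that(2-4) B2_aux_bidiag ..
    ultimately show ?thesis using diag_formula[OF that(1)] by simp
  qed
  {
    case 0
    then show ?case using a[of 0] rvec_first by (simp add: rvec_prev_def offdiag_def del: alg_a.simps alg_r.simps(2))
  next
    case (Suc k)
    then have IH: "alg_r n \<mu> \<beta> k = rvec_prev k" "alg_r n \<mu> \<beta> (Suc k) = rvec k"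
      "alg_b n \<mu> \<beta> k = offdiag k" "alg_a n \<mu> \<beta> (Suc k) = T $$ (k, k)" by auto
    have r: "alg_r n \<mu> \<beta> (Suc (Suc k)) = rvec (Suc k)"
      unfolding alg_r.simps(3) IH B2_aux_bidiag using rvec_recursion[OF Suc.prems] by simp
    have b: "alg_b n \<mu> \<beta> (Suc k) = offdiag (Suc k)"
      unfolding alg_b.simps(2) r IH by (rule offdiag_sqrt[OF Suc.prems])
    have p: "alg_r n \<mu> \<beta> (Suc k) = rvec_prev (Suc k)" using IH by (simp add: rvec_prev_def)
    show ?case using a[OF Suc.prems p r b] r b p by blast
  }
qed

lemma algorithm_well_defined:
  assumes "k \<in> {1..n}"
  shows "(\<forall>j < k - 1. alg_r n \<mu> \<beta> k $ j = 0) \<and> 0 < alg_r n \<mu> \<beta> k $ (k - 1)"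
proof -
  obtain m where m: "k = Suc m" "m < n" using assms by (cases k) auto
  then have "alg_r n \<mu> \<beta> k = rvec m" using algorithm_computes by blast
  then show ?thesis using m F_pos[of m] by (simp add: rvec_zero rvec_diag)
qed

lemma alg_output_eq: "alg_output n \<mu> \<beta> = T"
proof (rule eq_matI)
  fix i j assume "i < dim_row T" "j < dim_col T"
  then have ij: "i < n" "j < n" by auto
  have b: "alg_b n \<mu> \<beta> (Suc k) = T $$ (Suc k, k)" if "Suc k < n" for k
    using algorithm_computes[OF that] by (simp add: offdiag_def del: alg_a.simps alg_b.simps alg_r.simps)
  have a: "alg_a n \<mu> \<beta> (Suc k) = T $$ (k, k)" if "k < n" for k
    using algorithm_computes[OF that] by blast
  consider "i = j" | "j = Suc i" | "i = Suc j" | "i + 1 < j \<or> j + 1 < i" by linarith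
  then show "alg_output n \<mu> \<beta> $$ (i, j) = T $$ (i, j)"
  proof cases
    case 2
    then show ?thesis using ij b[of i] T_sym_entry[of i j] by (simp add: alg_output_def del: alg_a.simps alg_b.simps)
  next
    case 4
    then show ?thesis using ij T_zero[of i j] by (auto simp: alg_output_def simp del: alg_a.simps alg_b.simps)
  qed (use ij a b in \<open>auto simp: alg_output_def simp del: alg_a.simps alg_b.simps\<close>)
qed (auto simp: alg_output_def)

end

section \<open>Removing the permutation and the signs\<close>

lemma perm_mat_carrier [simp]: "perm_mat n \<pi> \<in> carrier_mat n n"
  by (simp add: perm_mat_def)

lemma perm_mat_mult_entry:
  assumes "\<pi> permutes {..<n}" "A \<in> carrier_mat n n" "i < n" "j < n"
  shows "((perm_mat n \<pi>)\<^sup>T * A) $$ (i, j) = A $$ (\<pi> i, j)"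
    and "(A * perm_mat n \<pi>) $$ (i, j) = A $$ (i, \<pi> j)"
proof -
  have p: "\<pi> i < n" "\<pi> j < n" using permutes_in_image[OF assms(1)] assms by auto
  have "((perm_mat n \<pi>)\<^sup>T * A) $$ (i, j) = (\<Sum>m<n. (perm_mat n \<pi>)\<^sup>T $$ (i, m) * A $$ (m, j))"
    using assms by (intro mult_entry) auto
  also have "\<dots> = (\<Sum>m<n. if m = \<pi> i then A $$ (m, j) else 0)"
    using assms(3) by (intro sum.cong) (auto simp: perm_mat_def)
  finally show "((perm_mat n \<pi>)\<^sup>T * A) $$ (i, j) = A $$ (\<pi> i, j)" using p by simp
  have "(A * perm_mat n \<pi>) $$ (i, j) = (\<Sum>m<n. A $$ (i, m) * perm_mat n \<pi> $$ (m, j))"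
    using assms by (intro mult_entry) auto
  also have "\<dots> = (\<Sum>m<n. if m = \<pi> j then A $$ (i, m) else 0)"
    using assms(4) by (intro sum.cong) (auto simp: perm_mat_def)
  finally show "(A * perm_mat n \<pi>) $$ (i, j) = A $$ (i, \<pi> j)" using p by simp
qed

lemma perm_mat_conj_diag:
  assumes "\<pi> permutes {..<n}"
  shows "(perm_mat n \<pi>)\<^sup>T * (diag_of n d * perm_mat n \<pi>) = diag_of n (d \<circ> \<pi>)"
proof (rule eq_matI)
  fix i j assume "i < dim_row (diag_of n (d \<circ> \<pi>))" "j < dim_col (diag_of n (d \<circ> \<pi>))"
  then have ij: "i < n" "j < n" by auto
  have p: "\<pi> i < n" "\<pi> j < n" using permutes_in_image[OF assms] ij by auto
  have "\<pi> i = \<pi> j \<longleftrightarrow> i = j" using permutes_inj[OF assms] by (auto dest: injD)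
  then show "((perm_mat n \<pi>)\<^sup>T * (diag_of n d * perm_mat n \<pi>)) $$ (i, j) = diag_of n (d \<circ> \<pi>) $$ (i, j)"
    using ij p by (simp add: perm_mat_mult_entry[OF assms] del: index_mult_mat(1)) (simp add: diag_of_def)
qed (auto simp: perm_mat_def)

lemma perm_mat_orthogonal:
  assumes "\<pi> permutes {..<n}"
  shows "(perm_mat n \<pi>)\<^sup>T * perm_mat n \<pi> = 1\<^sub>m n" "perm_mat n \<pi> * (perm_mat n \<pi>)\<^sup>T = 1\<^sub>m n"
    "inv_mat (perm_mat n \<pi>) = (perm_mat n \<pi>)\<^sup>T"
proof -
  have c: "perm_mat n \<pi> \<in> carrier_mat n n" "(perm_mat n \<pi>)\<^sup>T \<in> carrier_mat n n" by auto
  show 1: "(perm_mat n \<pi>)\<^sup>T * perm_mat n \<pi> = 1\<^sub>m n"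
    using perm_mat_conj_diag[OF assms, of "\<lambda>_. 1"] left_mult_one_mat[OF c(1)] by (simp add: diag_of_one)
  show 2: "perm_mat n \<pi> * (perm_mat n \<pi>)\<^sup>T = 1\<^sub>m n" by (rule mat_mult_left_right_inverse[OF c(2,1) 1])
  show "inv_mat (perm_mat n \<pi>) = (perm_mat n \<pi>)\<^sup>T" by (rule inv_mat_eq[OF c 2])
qed

text \<open>
  The factorization \<open>(Q\<^sub>\<pi>, L\<^sub>\<pi>, U\<^sub>\<pi>)\<close> of \<open>T\<close> in terms of the permuted eigenvalues alone: the
  orthogonal matrix \<open>E P\<^sub>\<pi>\<^sup>-\<^sup>1\<close> is absorbed into \<open>Q\<close>.
\<close>
definition lu_diagonalizes :: "nat \<Rightarrow> (nat \<Rightarrow> real) \<Rightarrow> real mat \<Rightarrow> real mat \<times> real mat \<times> real mat \<Rightarrow> bool" where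
  "lu_diagonalizes n \<mu> T = (\<lambda>(Q, L, U). real_orthogonal n Q \<and> T = Q\<^sup>T * diag_of n \<mu> * Q \<and> Q = L * U \<and>
     lower_unipotent n L \<and> upper_tri n U \<and> (\<forall>i<n. 0 < U $$ (i, i)))"

lemma orthogonal_conj:
  assumes "real_orthogonal n V" "real_orthogonal n Q"
  shows "real_orthogonal n (V * Q)"
    and "A \<in> carrier_mat n n \<Longrightarrow> (V * Q)\<^sup>T * A * (V * Q) = Q\<^sup>T * (V\<^sup>T * (A * V)) * Q"
proof -
  have c [simp]: "V \<in> carrier_mat n n" "Q \<in> carrier_mat n n" and o: "V\<^sup>T * V = 1\<^sub>m n" "Q\<^sup>T * Q = 1\<^sub>m n"
    using assms by (auto simp: real_orthogonal_def)
  have t: "(V * Q)\<^sup>T = Q\<^sup>T * V\<^sup>T" by (rule transpose_mult[of _ n n _ n]) auto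
  have "V\<^sup>T * (V * Q) = Q" by (rule mult_inverse_cancel[OF o(1)]) auto
  then have "(V * Q)\<^sup>T * (V * Q) = 1\<^sub>m n" by (simp add: t o assoc_mult_mat[of _ n n _ n _ n])
  then show "real_orthogonal n (V * Q)" by (simp add: real_orthogonal_def)
  show "A \<in> carrier_mat n n \<Longrightarrow> (V * Q)\<^sup>T * A * (V * Q) = Q\<^sup>T * (V\<^sup>T * (A * V)) * Q"
    by (simp add: t assoc_mult_mat[of _ n n _ n _ n])
qed

lemma perm_real_orthogonal:
  assumes "\<pi> permutes {..<n}"
  shows "real_orthogonal n (perm_mat n \<pi>)" "real_orthogonal n (perm_mat n \<pi>)\<^sup>T"
  using perm_mat_orthogonal[OF assms] by (auto simp: real_orthogonal_def)

lemma sign_real_orthogonal: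
  assumes "\<And>i. i < n \<Longrightarrow> \<epsilon> i = 1 \<or> \<epsilon> i = -1"
  shows "real_orthogonal n (diag_of n \<epsilon>)"
    "(diag_of n \<epsilon>)\<^sup>T * (diag_of n d * diag_of n \<epsilon>) = diag_of n d"
proof -
  have e: "\<epsilon> i * \<epsilon> i = 1" if "i < n" for i using assms[OF that] by auto
  then show "real_orthogonal n (diag_of n \<epsilon>)"
    by (simp add: real_orthogonal_def diag_of_mult diag_of_one)
  have "\<epsilon> i * (d i * \<epsilon> i) = d i" if "i < n" for i using e[OF that] by (simp add: mult_ac)
  then show "(diag_of n \<epsilon>)\<^sup>T * (diag_of n d * diag_of n \<epsilon>) = diag_of n d"
    unfolding diag_of_transpose diag_of_mult by (auto simp: diag_of_def)
qed

lemma perm_conj_diag_back: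
  assumes "\<pi> permutes {..<n}"
  shows "perm_mat n \<pi> * (diag_of n (d \<circ> \<pi>) * (perm_mat n \<pi>)\<^sup>T) = diag_of n d"
proof -
  let ?P = "perm_mat n \<pi>"
  have "?P * (diag_of n (d \<circ> \<pi>) * ?P\<^sup>T) = ?P * (?P\<^sup>T * (diag_of n d * (?P * ?P\<^sup>T)))"
    unfolding perm_mat_conj_diag[OF assms, symmetric] by (simp add: assoc_mult_mat[of _ n n _ n _ n])
  also have "\<dots> = diag_of n d * (?P * ?P\<^sup>T)"
    by (rule mult_inverse_cancel[OF perm_mat_orthogonal(2)[OF assms]]) auto
  finally show ?thesis by (simp add: perm_mat_orthogonal(2)[OF assms] right_mult_one_mat[of _ n n])
qed

lemma signed_perm_conj:
  assumes \<pi>: "\<pi> permutes {..<n}" and \<epsilon>: "\<And>i. i < n \<Longrightarrow> \<epsilon> i = 1 \<or> \<epsilon> i = -1" and Q: "real_orthogonal n Q"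
    and R: "R = diag_of n \<epsilon> * ((perm_mat n \<pi>)\<^sup>T * Q)"
  shows "real_orthogonal n R"
    and "R\<^sup>T * diag_of n (lam \<circ> \<pi>) * R = Q\<^sup>T * diag_of n lam * Q"
proof -
  note PQ = orthogonal_conj(1)[OF perm_real_orthogonal(2)[OF \<pi>] Q]
  note E = sign_real_orthogonal[of n \<epsilon>, OF \<epsilon>]
  show "real_orthogonal n R" unfolding R by (rule orthogonal_conj(1)[OF E(1) PQ])
  show "R\<^sup>T * diag_of n (lam \<circ> \<pi>) * R = Q\<^sup>T * diag_of n lam * Q"
    by (simp add: R orthogonal_conj(2)[OF E(1) PQ] E(2)[simplified]
        orthogonal_conj(2)[OF perm_real_orthogonal(2)[OF \<pi>] Q] perm_conj_diag_back[OF \<pi>])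
qed

lemma is_pi_factorization_iff:
  assumes \<pi>: "\<pi> permutes {..<n}"
  shows "is_pi_factorization n lam \<pi> T F \<longleftrightarrow> lu_diagonalizes n (lam \<circ> \<pi>) T F"
proof -
  obtain R L U where F: "F = (R, L, U)" by (cases F)
  let ?P = "perm_mat n \<pi>"
  have "(\<exists>Q E. real_orthogonal n Q \<and> T = Q\<^sup>T * diag_of n lam * Q \<and>
        sign_diagonal n E \<and> R = E * (inv_mat ?P * Q)) \<longleftrightarrow>
     real_orthogonal n R \<and> T = R\<^sup>T * diag_of n (lam \<circ> \<pi>) * R" (is "?l \<longleftrightarrow> ?r")
  proof
    assume ?l
    then obtain Q \<epsilon> where Q: "real_orthogonal n Q" "T = Q\<^sup>T * diag_of n lam * Q"
      and \<epsilon>: "\<And>i. i < n \<Longrightarrow> \<epsilon> i = 1 \<or> \<epsilon> i = -1" and R: "R = diag_of n \<epsilon> * (?P\<^sup>T * Q)"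
      by (auto simp: sign_diagonal_def perm_mat_orthogonal(3)[OF \<pi>])
    show ?r using signed_perm_conj(1)[OF \<pi> \<epsilon> Q(1) R] signed_perm_conj(2)[where lam = lam, OF \<pi> \<epsilon> Q(1) R] Q(2) by simp
  next
    assume r: ?r
    then have c [simp]: "R \<in> carrier_mat n n" by (simp add: real_orthogonal_def)
    have "diag_of n (\<lambda>_. 1) = 1\<^sub>m n" by (rule diag_of_one) simp
    moreover have "?P\<^sup>T * (?P * R) = R" by (rule mult_inverse_cancel[OF perm_mat_orthogonal(1)[OF \<pi>]]) auto
    ultimately have R: "R = 1\<^sub>m n * (inv_mat ?P * (?P * R))"
      by (simp add: perm_mat_orthogonal(3)[OF \<pi>] left_mult_one_mat[of _ n n])
    have s: "sign_diagonal n (1\<^sub>m n)" unfolding sign_diagonal_def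
      by (rule exI[of _ "\<lambda>_. 1"]) (simp add: diag_of_one)
    have "real_orthogonal n (?P * R)" "(?P * R)\<^sup>T * diag_of n lam * (?P * R) = T"
      using r orthogonal_conj[OF perm_real_orthogonal(1)[OF \<pi>], of R]
      by (auto simp: perm_mat_conj_diag[OF \<pi>])
    with R s show ?l by metis
  qed
  then show ?thesis
    unfolding F is_pi_factorization_def lu_diagonalizes_def upper_tri_iff by auto
qed

section \<open>Uniqueness of the factorization and the bidiagonal coordinates\<close>

text \<open>
  The orthogonal matrix \<open>W = Q' Q\<^sup>T\<close> commutes with a diagonal matrix with distinct entries, so it is
  a diagonal matrix of signs. The equation \<open>W L U = L' U'\<close> and the uniqueness of triangular
  factorizations identify these signs with the signs of quotients of diagonal entries of \<open>U'\<close> and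
  \<open>U\<close>, which are positive.
\<close>
lemma lu_diagonalizes_unique:
  assumes inj: "inj_on \<mu> {..<n}"
    and F: "lu_diagonalizes n \<mu> T (Q, L, U)" and F': "lu_diagonalizes n \<mu> T (Q', L', U')"
  shows "(Q', L', U') = (Q, L, U)"
proof -
  let ?M = "diag_of n \<mu>"
  note a = assoc_mult_mat[of _ n n _ n _ n]
  have Q: "Q\<^sup>T * Q = 1\<^sub>m n" "T = Q\<^sup>T * ?M * Q" "Q = L * U" "lower_unipotent n L" "upper_tri n U" "\<And>i. i < n \<Longrightarrow> 0 < U $$ (i, i)"
    and c [simp]: "Q \<in> carrier_mat n n" "L \<in> carrier_mat n n" "U \<in> carrier_mat n n"
    using F by (auto simp: lu_diagonalizes_def real_orthogonal_def lower_unipotent_def upper_tri_def)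
  have Q': "Q'\<^sup>T * Q' = 1\<^sub>m n" "T = Q'\<^sup>T * ?M * Q'" "Q' = L' * U'" "lower_unipotent n L'" "upper_tri n U'" "\<And>i. i < n \<Longrightarrow> 0 < U' $$ (i, i)"
    and c' [simp]: "Q' \<in> carrier_mat n n" "L' \<in> carrier_mat n n" "U' \<in> carrier_mat n n"
    using F' by (auto simp: lu_diagonalizes_def real_orthogonal_def lower_unipotent_def upper_tri_def)
  have QQt: "Q * Q\<^sup>T = 1\<^sub>m n" by (rule mat_mult_left_right_inverse[OF _ _ Q(1)]) auto
  have QQt': "Q' * Q'\<^sup>T = 1\<^sub>m n" by (rule mat_mult_left_right_inverse[OF _ _ Q'(1)]) auto
  define W where "W = Q' * Q\<^sup>T"
  have Wc [simp]: "W \<in> carrier_mat n n" by (simp add: W_def)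
  have WQ: "W * Q = Q'" by (simp add: W_def a Q(1) right_mult_one_mat[of _ n n])
  have "W * ?M = Q' * (T * Q\<^sup>T)"
    by (simp add: W_def Q(2) a QQt right_mult_one_mat[of _ n n])
  also have "\<dots> = ?M * W"
  proof -
    have "Q' * (Q'\<^sup>T * (?M * (Q' * Q\<^sup>T))) = ?M * (Q' * Q\<^sup>T)"
      by (rule mult_inverse_cancel[OF QQt']) auto
    then show ?thesis by (simp add: W_def Q'(2) a)
  qed
  finally have comm: "W * ?M = ?M * W" .
  have W0: "W $$ (i, j) = 0" if ij: "i < n" "j < n" "i \<noteq> j" for i j
  proof -
    have "W $$ (i, j) * \<mu> j = \<mu> i * W $$ (i, j)"
      using arg_cong[OF comm, of "\<lambda>A. A $$ (i, j)"] ij by (simp add: diag_of_mult_entry del: index_mult_mat(1))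
    moreover have "\<mu> i \<noteq> \<mu> j" using inj ij by (auto dest: inj_onD)
    ultimately show ?thesis by auto
  qed
  have Wl: "lower_tri n W" "lower_tri n W\<^sup>T" using W0 carrier_matD[OF Wc] by (auto simp: lower_tri_def)
  have Ll: "lower_tri n L" "lower_tri n L'" using Q Q' by (auto simp: lower_unipotent_tri)
  have Ld: "L $$ (i, i) = 1" "L' $$ (i, i) = 1" if "i < n" for i
    using that Q(4) Q'(4) by (auto simp: lower_unipotent_def)
  obtain K where K [simp]: "K \<in> carrier_mat n n" and LK: "L' * K = 1\<^sub>m n" and KL: "K * L' = 1\<^sub>m n"
    using right_inverse_if_det[OF c'(2)] lower_tri_det[OF Ll(2)] Ld by auto
  define X where "X = K * (W * L)"
  have Xc [simp]: "X \<in> carrier_mat n n" by (simp add: X_def)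
  have LX: "L' * X = W * L" unfolding X_def by (rule mult_inverse_cancel[OF LK]) auto
  have XU: "X * U = U'"
  proof -
    have "X * U = K * (W * Q)" by (simp add: X_def Q(3) a)
    also have "\<dots> = K * (L' * U')" by (simp only: WQ Q'(3))
    also have "\<dots> = U'" by (rule mult_inverse_cancel[OF KL]) auto
    finally show ?thesis .
  qed
  have Xl: "lower_tri n X"
    by (rule lower_tri_cancel_left[OF Ll(2)]) (auto simp: Ld LX lower_tri_mult(1)[OF Wl(1) Ll(1)])
  have Xu: "upper_tri n X"
    by (rule upper_tri_cancel_right[OF Q(5)]) (use Q(6) Q'(5) XU in \<open>auto simp: less_imp_neq[symmetric]\<close>)
  have XW: "X $$ (i, i) = W $$ (i, i)" if "i < n" for i
    using lower_tri_mult(2)[OF Ll(2) Xl that] lower_tri_mult(2)[OF Wl(1) Ll(1) that] Ld[OF that] by (simp add: LX)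
  have Wpos: "0 < W $$ (i, i)" if "i < n" for i
    using upper_tri_mult(2)[OF Xu Q(5) that] Q(6)[OF that] Q'(6)[OF that] XW[OF that]
    by (simp add: XU zero_less_mult_iff)
  have "W\<^sup>T * W = 1\<^sub>m n"
  proof -
    have "W\<^sup>T = Q\<^sup>T\<^sup>T * Q'\<^sup>T" unfolding W_def by (rule transpose_mult[of _ n n _ n]) auto
    moreover have "Q'\<^sup>T * (Q' * Q\<^sup>T) = Q\<^sup>T" by (rule mult_inverse_cancel[OF Q'(1)]) auto
    ultimately show ?thesis by (simp add: a W_def QQt)
  qed
  then have Wsq: "W $$ (i, i) * W $$ (i, i) = 1" if "i < n" for i
    using lower_tri_mult(2)[OF Wl(2,1) that] that carrier_matD[OF Wc] by simp
  have Wd: "W $$ (i, i) = 1" if "i < n" for i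
    using Wsq[OF that] Wpos[OF that] power2_eq_1_iff[of "W $$ (i, i)"] by (auto simp: power2_eq_square)
  have W1: "W = 1\<^sub>m n"
    using W0 Wd carrier_matD[OF Wc] by (intro eq_matI) auto
  have X1: "X = 1\<^sub>m n"
    using Xl Xu Wd XW carrier_matD[OF Xc]
    by (intro eq_matI) (auto simp: lower_tri_def upper_tri_def, metis linorder_neqE_nat)
  show ?thesis
    using WQ LX XU unfolding W1 X1
    by (simp add: left_mult_one_mat[of _ n n] right_mult_one_mat[of _ n n])
qed

lemma spectrum_orthogonal_diag:
  assumes "real_orthogonal n Q"
  shows "spectrum (Q\<^sup>T * diag_of n d * Q) = d ` {..<n}"
proof -
  let ?D = "diag_of n d" and ?T = "Q\<^sup>T * diag_of n d * Q"
  have c [simp]: "Q \<in> carrier_mat n n" and o: "Q\<^sup>T * Q = 1\<^sub>m n" using assms by (auto simp: real_orthogonal_def)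
  have o': "Q * Q\<^sup>T = 1\<^sub>m n" by (rule mat_mult_left_right_inverse[OF _ _ o]) auto
  have T: "?T \<in> carrier_mat n n" by simp
  have "similar_mat ?T ?D"
    by (rule similar_matI[of _ _ "Q\<^sup>T" Q n]) (auto simp: o o')
  then have "char_poly ?T = char_poly ?D" by (rule char_poly_similar)
  also have "\<dots> = (\<Prod>a\<leftarrow>diag_mat ?D. [:- a, 1:])"
    by (rule char_poly_upper_triangular[of _ n]) (auto simp: diag_of_def)
  finally have cp: "char_poly ?T = (\<Prod>a\<leftarrow>diag_mat ?D. [:- a, 1:])" .
  have "set (diag_mat ?D) = d ` {..<n}" by (auto simp: diag_mat_def diag_of_def)
  then show ?thesis
    unfolding spectrum_def eigenvalue_root_char_poly[OF T] cp
    by (auto simp: poly_prod_list prod_list_zero_iff o_def)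
qed

text \<open>
  In the definition of the domain the diagonal of \<open>U\<close> is only nonzero; its signs are moved into
  the orthogonal factor, and \<open>L\<close> is conjugated by them to keep its unit diagonal.
\<close>
lemma bidiag_domain_iff:
  assumes \<pi>: "\<pi> permutes {..<n}"
  shows "T \<in> bidiag_domain n lam \<pi> \<longleftrightarrow> sym_tridiagonal n T \<and> (\<exists>F. lu_diagonalizes n (lam \<circ> \<pi>) T F)"
proof
  let ?P = "perm_mat n \<pi>"
  note a = assoc_mult_mat[of _ n n _ n _ n]
  assume "T \<in> bidiag_domain n lam \<pi>"
  then obtain Q L U where T: "sym_tridiagonal n T" "T = Q\<^sup>T * diag_of n lam * Q"
    and Q: "real_orthogonal n Q" and L: "lower_unipotent n L" and U: "upper_tri n U" and LU: "?P\<^sup>T * Q = L * U"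
    by (auto simp: bidiag_domain_def isospectral_tridiag_def upper_tri_iff perm_mat_orthogonal(3)[OF \<pi>])
  have c [simp]: "Q \<in> carrier_mat n n" "L \<in> carrier_mat n n" "U \<in> carrier_mat n n"
    using Q L U by (auto simp: real_orthogonal_def lower_unipotent_def upper_tri_def)
  have "det (L * U) \<noteq> 0"
  proof -
    have "real_orthogonal n (L * U)"
      using orthogonal_conj(1)[OF perm_real_orthogonal(2)[OF \<pi>] Q] LU by simp
    then have "det ((L * U)\<^sup>T) * det (L * U) = 1"
      using det_mult[of "(L * U)\<^sup>T" n "L * U"] by (simp add: real_orthogonal_def)
    then show ?thesis by auto
  qed
  then have "det U \<noteq> 0" by (simp add: det_mult[of _ n])
  then have Ud: "U $$ (i, i) \<noteq> 0" if "i < n" for i using upper_tri_det[OF U] that by auto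
  define \<epsilon> where "\<epsilon> i = sgn (U $$ (i, i))" for i
  have \<epsilon>: "\<epsilon> i = 1 \<or> \<epsilon> i = -1" if "i < n" for i using Ud[OF that] by (auto simp: \<epsilon>_def sgn_if)
  let ?E = "diag_of n \<epsilon>"
  have EE: "?E * ?E = 1\<^sub>m n"
    using sign_real_orthogonal(1)[of n \<epsilon>, OF \<epsilon>] by (simp add: real_orthogonal_def)
  define R where "R = ?E * (?P\<^sup>T * Q)"
  have fac: "R = (?E * L * ?E) * (?E * U)"
  proof -
    have "?E * (?E * U) = U" by (rule mult_inverse_cancel[OF EE]) auto
    then show ?thesis by (simp add: R_def LU a)
  qed
  have e: "(?E * L * ?E) $$ (i, j) = \<epsilon> i * L $$ (i, j) * \<epsilon> j" "(?E * U) $$ (i, j) = \<epsilon> i * U $$ (i, j)" if "i < n" "j < n" for i j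
    using that by (simp_all add: diag_of_mult_entry del: index_mult_mat(1))
  have "\<epsilon> i * \<epsilon> i = 1" if "i < n" for i using \<epsilon>[OF that] by auto
  then have "lower_unipotent n (?E * L * ?E)"
    using L by (auto simp: lower_unipotent_def e simp del: index_mult_mat(1))
  moreover have "upper_tri n (?E * U)" using U by (auto simp: upper_tri_def e simp del: index_mult_mat(1))
  moreover have "0 < (?E * U) $$ (i, i)" if "i < n" for i
    using Ud[OF that] that by (simp add: e \<epsilon>_def abs_sgn[symmetric] mult.commute[of "sgn _"] del: index_mult_mat(1))
  moreover have "real_orthogonal n R" and "R\<^sup>T * diag_of n (lam \<circ> \<pi>) * R = T"
    using signed_perm_conj[OF \<pi> _ Q R_def] \<epsilon> T(2) by blast+
  ultimately have "lu_diagonalizes n (lam \<circ> \<pi>) T (R, ?E * L * ?E, ?E * U)"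
    unfolding lu_diagonalizes_def using fac by auto
  with T(1) show "sym_tridiagonal n T \<and> (\<exists>F. lu_diagonalizes n (lam \<circ> \<pi>) T F)" by blast
next
  let ?P = "perm_mat n \<pi>"
  assume "sym_tridiagonal n T \<and> (\<exists>F. lu_diagonalizes n (lam \<circ> \<pi>) T F)"
  then obtain R L U where T: "sym_tridiagonal n T" "T = R\<^sup>T * diag_of n (lam \<circ> \<pi>) * R"
    and R: "real_orthogonal n R" and L: "lower_unipotent n L" and U: "upper_tri n U" and LU: "R = L * U"
    by (auto simp: lu_diagonalizes_def)
  have [simp]: "R \<in> carrier_mat n n" using R by (simp add: real_orthogonal_def)
  have "spectrum T = lam ` \<pi> ` {..<n}"
    unfolding T(2) spectrum_orthogonal_diag[OF R] by (simp add: image_comp)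
  then have sp: "spectrum T = lam ` {..<n}" by (simp add: permutes_image[OF \<pi>])
  have "?P\<^sup>T * (?P * R) = R" by (rule mult_inverse_cancel[OF perm_mat_orthogonal(1)[OF \<pi>]]) auto
  moreover have "real_orthogonal n (?P * R)" "T = (?P * R)\<^sup>T * diag_of n lam * (?P * R)"
    using R T(2) orthogonal_conj[OF perm_real_orthogonal(1)[OF \<pi>], of R]
    by (auto simp: perm_mat_conj_diag[OF \<pi>])
  ultimately show "T \<in> bidiag_domain n lam \<pi>"
    unfolding bidiag_domain_def isospectral_tridiag_def perm_mat_orthogonal(3)[OF \<pi>]
    using T(1) sp L U LU upper_tri_iff by blast
qed

lemma psi_eq:
  assumes "\<pi> permutes {..<n}" "inj_on (lam \<circ> \<pi>) {..<n}" "lu_diagonalizes n (lam \<circ> \<pi>) T (Q, L, U)"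
  shows "psi n lam \<pi> T = vec (n - 1) (\<lambda>i. (inv_mat L * diag_of n (lam \<circ> \<pi>) * L) $$ (i + 1, i))"
proof -
  have "pi_factorization n lam \<pi> T = (Q, L, U)"
    unfolding pi_factorization_def is_pi_factorization_iff[OF assms(1)]
  proof (rule the_equality)
    show "F = (Q, L, U)" if "lu_diagonalizes n (lam \<circ> \<pi>) T F" for F
      using that lu_diagonalizes_unique[OF assms(2,3)] by (cases F) blast
  qed (rule assms(3))
  then show ?thesis by (simp add: psi_def bidiag_mat_def)
qed

lemma lu_diagonalizes_inv_lower:
  assumes "lu_diagonalizes n \<mu> T (Q, L, U)"
  shows "inv_mat L = U * Q\<^sup>T" "L * (U * Q\<^sup>T) = 1\<^sub>m n" "U * Q\<^sup>T * L = 1\<^sub>m n"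
proof -
  have Q: "Q\<^sup>T * Q = 1\<^sub>m n" "Q = L * U" and [simp]: "Q \<in> carrier_mat n n" "L \<in> carrier_mat n n" "U \<in> carrier_mat n n"
    using assms by (auto simp: lu_diagonalizes_def real_orthogonal_def lower_unipotent_def upper_tri_def)
  have "Q * Q\<^sup>T = 1\<^sub>m n" by (rule mat_mult_left_right_inverse[OF _ _ Q(1)]) auto
  moreover have "L * (U * Q\<^sup>T) = L * U * Q\<^sup>T" by (simp add: assoc_mult_mat[of _ n n _ n _ n])
  ultimately show 1: "L * (U * Q\<^sup>T) = 1\<^sub>m n" using Q(2) by simp
  show "inv_mat L = U * Q\<^sup>T" by (rule inv_mat_eq[OF _ _ 1]) auto
  show "U * Q\<^sup>T * L = 1\<^sub>m n" by (rule mat_mult_left_right_inverse[OF _ _ 1]) auto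
qed

text \<open>
  The matrix \<open>L\<^sup>-\<^sup>1 M L\<close> is lower triangular as it stands, and it is a Hessenberg matrix as the
  conjugate of the tridiagonal \<open>T\<close> by the upper triangular \<open>U\<close>.
\<close>
lemma bidiagonal_form:
  assumes F: "lu_diagonalizes n \<mu> T (Q, L, U)" and T: "sym_tridiagonal n T"
  shows "inv_mat L * diag_of n \<mu> * L = bidiag n \<mu> (vec (n - 1) (\<lambda>i. (inv_mat L * diag_of n \<mu> * L) $$ (i + 1, i))) 1"
    and "diag_of n \<mu> * L = L * (inv_mat L * diag_of n \<mu> * L)"
proof -
  let ?M = "diag_of n \<mu>"
  note a = assoc_mult_mat[of _ n n _ n _ n]
  have Q: "T = Q\<^sup>T * ?M * Q" "Q = L * U" and L: "lower_unipotent n L" and U: "upper_tri n U"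
    and Up: "\<And>i. i < n \<Longrightarrow> 0 < U $$ (i, i)"
    and [simp]: "Q \<in> carrier_mat n n" "L \<in> carrier_mat n n" "U \<in> carrier_mat n n"
    using F by (auto simp: lu_diagonalizes_def real_orthogonal_def lower_unipotent_def upper_tri_def)
  note inv = lu_diagonalizes_inv_lower[OF F]
  define X where "X = inv_mat L * ?M * L"
  have Xc [simp]: "X \<in> carrier_mat n n" by (simp add: X_def inv)
  have LX: "L * X = ?M * L"
  proof -
    have "L * X = L * ((U * Q\<^sup>T) * (?M * L))" by (simp add: X_def inv a)
    also have "\<dots> = ?M * L" by (rule mult_inverse_cancel[OF inv(2)]) auto
    finally show ?thesis .
  qed
  then show "?M * L = L * (inv_mat L * ?M * L)" by (simp add: X_def)
  have Ll: "lower_tri n L" and Ld: "\<And>i. i < n \<Longrightarrow> L $$ (i, i) = 1"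
    using L by (auto simp: lower_unipotent_tri lower_unipotent_def)
  have Ml: "lower_tri n ?M" by (auto simp: lower_tri_def diag_of_def)
  have Xl: "lower_tri n X"
    by (rule lower_tri_cancel_left[OF Ll]) (auto simp: Ld LX lower_tri_mult(1)[OF Ml Ll])
  have Xd: "X $$ (i, i) = \<mu> i" if "i < n" for i
    using lower_tri_mult(2)[OF Ll Xl that] Ld that
    by (simp add: LX diag_of_mult_entry del: index_mult_mat(1))
  obtain V where V [simp]: "V \<in> carrier_mat n n" and UV: "U * V = 1\<^sub>m n" and VU: "V * U = 1\<^sub>m n"
  proof (rule right_inverse_if_det[of U n])
    show "det U \<noteq> 0" unfolding upper_tri_det[OF U] using Up by (metis less_irrefl)
  qed auto
  have Vu: "upper_tri n V"
  proof (rule upper_tri_cancel_right[OF U])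
    show "U $$ (i, i) \<noteq> 0" if "i < n" for i using Up[OF that] by simp
  qed (auto simp: VU upper_tri_def)
  have LV: "L = Q * V" by (simp add: Q(2) a UV right_mult_one_mat[of _ n n])
  have "X = U * Q\<^sup>T * ?M * L" by (simp only: X_def inv(1))
  also have "\<dots> = U * Q\<^sup>T * ?M * (Q * V)" by (simp only: LV)
  also have "\<dots> = U * T * V" by (simp add: Q(1) a)
  finally have "X = U * T * V" .
  moreover have "upper_hess n T" using T by (auto simp: sym_tridiagonal_def upper_hess_def)
  ultimately have Xh: "upper_hess n X" using U Vu upper_hess_mult by blast
  have "X $$ (i, j) = bidiag n \<mu> (vec (n - 1) (\<lambda>i. X $$ (i + 1, i))) 1 $$ (i, j)" if ij: "i < n" "j < n" for i j
  proof -
    consider "i = j" | "i = Suc j" | "i < j" | "j + 1 < i" by linarith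
    then show ?thesis
    proof cases
      case 3
      then show ?thesis using Xl ij by (auto simp: lower_tri_def bidiag_def)
    next
      case 4
      then show ?thesis using Xh ij by (auto simp: upper_hess_def bidiag_def)
    qed (use ij Xd in \<open>auto simp: bidiag_def\<close>)
  qed
  then have "X = bidiag n \<mu> (vec (n - 1) (\<lambda>i. X $$ (i + 1, i))) 1"
    using carrier_matD[OF Xc] by (intro eq_matI) (auto simp: bidiag_def)
  then show "inv_mat L * ?M * L = bidiag n \<mu> (vec (n - 1) (\<lambda>i. (inv_mat L * ?M * L) $$ (i + 1, i))) 1"
    by (simp only: X_def)
qed

lemma (in triangular_orthogonalizer) alg_output_diagonalized:
  "lu_diagonalizes n \<mu> (alg_output n \<mu> \<beta>) (Q, L, U)"
  using QtQ U U_pos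
  by (simp add: lu_diagonalizes_def real_orthogonal_def alg_output_eq T_def L_aux_unipotent Q_def del: One_nat_def)

section \<open>Correctness of the inverse bidiagonal algorithm\<close>

theorem mainTheorem1:
  fixes n :: nat and lam :: "nat \<Rightarrow> real" and \<pi> :: "nat \<Rightarrow> nat" and \<beta> :: "real vec"
  assumes "1 \<le> n"
    and "strict_mono_on {..<n} lam"
    and "\<pi> permutes {..<n}"
    and "\<beta> \<in> carrier_vec (n - 1)"
  shows "(\<forall>k \<in> {1..n}.
            (\<forall>j < k - 1. alg_r n (lam \<circ> \<pi>) \<beta> k $ j = 0) \<and> 0 < alg_r n (lam \<circ> \<pi>) \<beta> k $ (k - 1))
       \<and> alg_output n (lam \<circ> \<pi>) \<beta> = phi n lam \<pi> \<beta>
       \<and> alg_output n (lam \<circ> \<pi>) \<beta> \<in> bidiag_domain n lam \<pi>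
       \<and> psi n lam \<pi> (alg_output n (lam \<circ> \<pi>) \<beta>) = \<beta>
       \<and> (\<forall>T \<in> bidiag_domain n lam \<pi>. psi n lam \<pi> T = \<beta> \<longrightarrow> T = alg_output n (lam \<circ> \<pi>) \<beta>)"
proof -
  note \<pi> = assms(3)
  let ?\<mu> = "lam \<circ> \<pi>"
  let ?A = "alg_output n ?\<mu> \<beta>" and ?L = "L_aux n ?\<mu> \<beta> 1"
  have "inj_on lam {..<n}" by (rule strict_mono_on_imp_inj_on[OF assms(2)])
  then have inj: "inj_on ?\<mu> {..<n}"
    using \<pi> by (intro comp_inj_on) (auto simp: permutes_inj_on permutes_image)
  \<comment> \<open>a matrix with coordinates \<open>\<beta>\<close> exists, and the algorithm returns it\<close>
  obtain U where U: "upper_tri n U" "\<And>i. i < n \<Longrightarrow> 0 < U $$ (i, i)" "(?L * U)\<^sup>T * (?L * U) = 1\<^sub>m n"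
    using orthonormalize_columns[OF L_aux_unipotent] by blast
  interpret triangular_orthogonalizer n ?\<mu> \<beta> U
    using inj U by unfold_locales auto
  note F = alg_output_diagonalized
  have dom: "?A \<in> bidiag_domain n lam \<pi>"
    unfolding bidiag_domain_iff[OF \<pi>] using F T_tridiagonal alg_output_eq by auto
  have "inv_mat L * M * L = B"
  proof -
    note inv = lu_diagonalizes_inv_lower[OF F]
    have "inv_mat L * M * L = (U * Q\<^sup>T) * (L * B)"
      unfolding inv(1) diag_mult_L_aux[OF inj, symmetric]
      by (simp add: assoc_mult_mat[of _ n n _ n _ n] del: One_nat_def)
    also have "\<dots> = B" by (rule mult_inverse_cancel[OF inv(3)]) auto
    finally show ?thesis .
  qed
  then have psi: "psi n lam \<pi> ?A = \<beta>"
    unfolding psi_eq[OF \<pi> inj F] using assms(4) by (intro eq_vecI) (auto simp: bidiag_def)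
  have uniq: "T' = ?A" if T': "T' \<in> bidiag_domain n lam \<pi>" "psi n lam \<pi> T' = \<beta>" for T'
  proof -
    obtain Q' L' U' where F': "lu_diagonalizes n ?\<mu> T' (Q', L', U')" and t: "sym_tridiagonal n T'"
      using T'(1) unfolding bidiag_domain_iff[OF \<pi>] by auto
    have "inv_mat L' * M * L' = bidiag n ?\<mu> \<beta> 1"
      using bidiagonal_form(1)[OF F' t] T'(2) unfolding psi_eq[OF \<pi> inj F'] by simp
    then have "M * L' = L' * bidiag n ?\<mu> \<beta> 1" using bidiagonal_form(2)[OF F' t] by simp
    then have L': "L' = ?L"
      using F' by (intro eigenvector_matrix_unique[OF inj]) (auto simp: lu_diagonalizes_def)
    \<comment> \<open>the algorithm, which depends on \<open>\<beta>\<close> only, returns \<open>T'\<close> as well\<close>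
    interpret other: triangular_orthogonalizer n ?\<mu> \<beta> U'
      using inj F' L' by unfold_locales (auto simp: lu_diagonalizes_def real_orthogonal_def)
    have "T' = other.T"
      using F' L' by (auto simp: other.T_def other.Q_def lu_diagonalizes_def)
    then show ?thesis by (simp add: other.alg_output_eq)
  qed
  have phi: "phi n lam \<pi> \<beta> = ?A"
    unfolding phi_def the_inv_into_def
  proof (rule the_equality)
    show "?A \<in> bidiag_domain n lam \<pi> \<and> psi n lam \<pi> ?A = \<beta>" using dom psi by blast
  qed (use uniq in blast)
  show ?thesis using algorithm_well_defined phi[symmetric] dom psi uniq by blast
qed

end
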